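(* Let $(X,d)$ be a geodesic metric space. The following facts are equivalent: (1) $X$ is hyperbolic; (2) for any choice of a non-principal ultrafilter $\omega$ on $\mathbb{N}$, a sequence of basepoints $(x_n)\subseteq X$ and a sequence of rescaling factors $(d_n)$ of positive reals diverging to infinity, the asymptotic cone $X_\omega((x_n),(d_n))$ is a real tree; (3) $\liminf_{t\to\infty} G_X(t)/t>30$; (4) $\limsup_{t\to\infty}\Omega_X(t)/t<1/32$.
   Context: A map $\gamma\colon[0,1]\to X$ is a geodesic if there is $k\ge 0$ with $d(\gamma(t),\gamma(s))=k|t-s|$ for all $t,s\in[0,1]$; geodesics are identified with their images, and $[x,y]$ denotes a geodesic joining $x$ to $y$ (not necessarily unique). $X$ is geodesic if any two of its points can be joined by a geodesic. A triangle $\Delta=\Delta(x,y,z)$ is the union of three geodesics $[x,y],[y,z],[z,x]$ (its sides), with perimeter $\mathrm{pr}(\Delta)=d(x,y)+d(y,z)+d(z,x)$. A triangle with sides $\ell_1,\ell_2,\ell_3$ satisfies the Rips condition with constant $\delta$ if, whenever $\{i,j,k\}=\{1,2,3\}$, every point of $\ell_i$ is at distance at most $\delta$ from $\ell_j\cup\ell_k$. A geodesic space is $\delta$-hyperbolic if every triangle in it satisfies the Rips condition with constant $\delta$, hyperbolic if it is $\delta$-hyperbolic for some $\delta\ge 0$, and a real tree if it is $0$-hyperbolic. Let $\delta(\Delta)=\inf\{\delta:\ \Delta \text{ satisfies the Rips condition with constant } \delta\}$ and, for $t>0$, $\Omega_X(t)=\sup\{\delta(\Delta):\ \Delta \text{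 a triangle in } X \text{ with } \mathrm{pr}(\Delta)\le t\}$. For $t>0$, a $t$-detour in $X$ is a continuous map $\gamma\colon[0,1]\to X$ such that there exist a geodesic $[\gamma(0),\gamma(1)]$ and a point $z\in[\gamma(0),\gamma(1)]$ with $d(z,\mathrm{Im}\,\gamma)\ge t$. Set $G_X(t)=\inf\{\mathrm{length}(\gamma):\ \gamma \text{ is a } t\text{-detour}\}\in(0,\infty]$, equal to $\infty$ if there are no rectifiable $t$-detours. An ultrafilter on $\mathbb{N}$ is non-principal if it contains no finite subset of $\mathbb{N}$. For a sequence $(a_n)$ in $[0,+\infty]$, $\omega\text{-}\lim a_n=a$ means that for every neighbourhood $U$ of $a$ the set $\{n:\ a_n\in U\}$ belongs to $\omega$ (such a limit exists and is unique). The asymptotic cone $X_\omega((x_n),(d_n))$ is the set of sequences $(y_n)\subseteq X$ with $\omega\text{-}\lim d(x_n,y_n)/d_n<+\infty$, modulo the relation $(y_n)\sim(z_n)\Leftrightarrow\omega\text{-}\lim d(y_n,z_n)/d_n=0$, endowed with the distance $d_\omega([(y_n)],[(z_n)])=\omega\text{-}\lim d(y_n,z_n)/d_n$. *)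

theory Defs
  imports "HOL-Analysis.Analysis"
begin

text \<open>
  A metric space is given by a carrier \<open>M\<close> and a distance \<open>d\<close> (locale \<^locale>\<open>Metric_space\<close>), because
  the same notions are applied to asymptotic cones, whose points are sets of sequences.
\<close>

section \<open>Geodesics and triangles\<close>

definition geodesic_map :: "'a set \<Rightarrow> ('a \<Rightarrow> 'a \<Rightarrow> real) \<Rightarrow> (real \<Rightarrow> 'a) \<Rightarrow> bool" where
  "geodesic_map M d \<gamma> \<longleftrightarrow>
     \<gamma> ` {0..1} \<subseteq> M \<and>
     (\<exists>k\<ge>0. \<forall>t\<in>{0..1}. \<forall>s\<in>{0..1}. d (\<gamma> t) (\<gamma> s) = k * \<bar>t - s\<bar>)"

text \<open>\<open>geodesic_between M d x y l\<close>: the set \<open>l\<close> is (the image of) a geodesic \<open>[x,y]\<close>.\<close>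

definition geodesic_between :: "'a set \<Rightarrow> ('a \<Rightarrow> 'a \<Rightarrow> real) \<Rightarrow> 'a \<Rightarrow> 'a \<Rightarrow> 'a set \<Rightarrow> bool" where
  "geodesic_between M d x y l \<longleftrightarrow>
     (\<exists>\<gamma>. geodesic_map M d \<gamma> \<and> \<gamma> 0 = x \<and> \<gamma> 1 = y \<and> l = \<gamma> ` {0..1})"

definition geodesic_space :: "'a set \<Rightarrow> ('a \<Rightarrow> 'a \<Rightarrow> real) \<Rightarrow> bool" where
  "geodesic_space M d \<longleftrightarrow>
     Metric_space M d \<and> (\<forall>x\<in>M. \<forall>y\<in>M. \<exists>l. geodesic_between M d x y l)"

text \<open>
  A triangle is represented by its vertices \<open>x, y, z\<close> and its sides \<open>l1, l2, l3\<close>.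
\<close>

definition triangle_in ::
  "'a set \<Rightarrow> ('a \<Rightarrow> 'a \<Rightarrow> real) \<Rightarrow> 'a \<Rightarrow> 'a \<Rightarrow> 'a \<Rightarrow> 'a set \<Rightarrow> 'a set \<Rightarrow> 'a set \<Rightarrow> bool" where
  "triangle_in M d x y z l1 l2 l3 \<longleftrightarrow>
     geodesic_between M d x y l1 \<and> geodesic_between M d y z l2 \<and> geodesic_between M d z x l3"

definition perimeter :: "('a \<Rightarrow> 'a \<Rightarrow> real) \<Rightarrow> 'a \<Rightarrow> 'a \<Rightarrow> 'a \<Rightarrow> real" where
  "perimeter d x y z = d x y + d y z + d z x"

text \<open>Only meaningful for nonempty \<open>A\<close>.\<close>

definition dist_to_set :: "('a \<Rightarrow> 'a \<Rightarrow> real) \<Rightarrow> 'a \<Rightarrow> 'a set \<Rightarrow> real" where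
  "dist_to_set d p A = (INF a\<in>A. d p a)"

definition rips :: "('a \<Rightarrow> 'a \<Rightarrow> real) \<Rightarrow> real \<Rightarrow> 'a set \<Rightarrow> 'a set \<Rightarrow> 'a set \<Rightarrow> bool" where
  "rips d \<delta> l1 l2 l3 \<longleftrightarrow>
     (\<forall>p\<in>l1. dist_to_set d p (l2 \<union> l3) \<le> \<delta>) \<and>
     (\<forall>p\<in>l2. dist_to_set d p (l1 \<union> l3) \<le> \<delta>) \<and>
     (\<forall>p\<in>l3. dist_to_set d p (l1 \<union> l2) \<le> \<delta>)"

section \<open>Hyperbolic spaces and real trees\<close>

definition delta_hyperbolic :: "'a set \<Rightarrow> ('a \<Rightarrow> 'a \<Rightarrow> real) \<Rightarrow> real \<Rightarrow> bool" where
  "delta_hyperbolic M d \<delta> \<longleftrightarrow>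
     geodesic_space M d \<and>
     (\<forall>x y z l1 l2 l3. triangle_in M d x y z l1 l2 l3 \<longrightarrow> rips d \<delta> l1 l2 l3)"

definition hyperbolic :: "'a set \<Rightarrow> ('a \<Rightarrow> 'a \<Rightarrow> real) \<Rightarrow> bool" where
  "hyperbolic M d \<longleftrightarrow> (\<exists>\<delta>\<ge>0. delta_hyperbolic M d \<delta>)"

definition real_tree :: "'a set \<Rightarrow> ('a \<Rightarrow> 'a \<Rightarrow> real) \<Rightarrow> bool" where
  "real_tree M d \<longleftrightarrow> delta_hyperbolic M d 0"

section \<open>The functions \<open>\<Omega>\<close> and \<open>G\<close>\<close>

definition triangle_delta :: "('a \<Rightarrow> 'a \<Rightarrow> real) \<Rightarrow> 'a set \<Rightarrow> 'a set \<Rightarrow> 'a set \<Rightarrow> real" where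
  "triangle_delta d l1 l2 l3 = Inf {\<delta>. rips d \<delta> l1 l2 l3}"

definition Omega :: "'a set \<Rightarrow> ('a \<Rightarrow> 'a \<Rightarrow> real) \<Rightarrow> real \<Rightarrow> ennreal" where
  "Omega M d t =
     Sup {ennreal (triangle_delta d l1 l2 l3) | x y z l1 l2 l3.
            triangle_in M d x y z l1 l2 l3 \<and> perimeter d x y z \<le> t}"

text \<open>
  The length of a curve on \<open>[0,1]\<close>: the supremum of the lengths of the polygons
  inscribed along the subdivisions \<open>0 = p 0 \<le> \<dots> \<le> p n = 1\<close>.
\<close>

definition curve_length :: "('a \<Rightarrow> 'a \<Rightarrow> real) \<Rightarrow> (real \<Rightarrow> 'a) \<Rightarrow> ennreal" where
  "curve_length d \<gamma> =
     Sup {(\<Sum>i<n. ennreal (d (\<gamma> (p i)) (\<gamma> (p (Suc i))))) | (n::nat) (p::nat \<Rightarrow> real).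
            p 0 = 0 \<and> p n = 1 \<and> (\<forall>i<n. p i \<le> p (Suc i))}"

definition detour :: "'a set \<Rightarrow> ('a \<Rightarrow> 'a \<Rightarrow> real) \<Rightarrow> real \<Rightarrow> (real \<Rightarrow> 'a) \<Rightarrow> bool" where
  "detour M d t \<gamma> \<longleftrightarrow>
     continuous_map (top_of_set {0..1}) (Metric_space.mtopology M d) \<gamma> \<and>
     (\<exists>l. geodesic_between M d (\<gamma> 0) (\<gamma> 1) l \<and>
          (\<exists>z\<in>l. dist_to_set d z (\<gamma> ` {0..1}) \<ge> t))"

definition detour_G :: "'a set \<Rightarrow> ('a \<Rightarrow> 'a \<Rightarrow> real) \<Rightarrow> real \<Rightarrow> ennreal" where
  "detour_G M d t = (INF \<gamma>\<in>{\<gamma>. detour M d t \<gamma>}. curve_length d \<gamma>)"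

section \<open>Ultrafilters and asymptotic cones\<close>

text \<open>A set \<open>A\<close> belongs to the filter \<open>\<omega>\<close> iff \<open>eventually (\<lambda>n. n \<in> A) \<omega>\<close>.\<close>

definition ultrafilter :: "'b filter \<Rightarrow> bool" where
  "ultrafilter \<omega> \<longleftrightarrow>
     \<omega> \<noteq> bot \<and>
     (\<forall>A. eventually (\<lambda>n. n \<in> A) \<omega> \<or> eventually (\<lambda>n. n \<in> - A) \<omega>)"

definition nonprincipal :: "'b filter \<Rightarrow> bool" where
  "nonprincipal \<omega> \<longleftrightarrow> (\<forall>F. finite F \<longrightarrow> \<not> eventually (\<lambda>n. n \<in> F) \<omega>)"

text \<open>
  \<^term>\<open>Lim\<close> along an ultrafilter; existence and uniqueness are proved below (\<open>ultralim_tendsto\<close>,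
  \<open>ultralim_eqI\<close>).
\<close>

definition ultralim :: "nat filter \<Rightarrow> (nat \<Rightarrow> ennreal) \<Rightarrow> ennreal" where
  "ultralim \<omega> a = Lim \<omega> a"

definition cone_lim ::
  "('a \<Rightarrow> 'a \<Rightarrow> real) \<Rightarrow> nat filter \<Rightarrow> (nat \<Rightarrow> real) \<Rightarrow> (nat \<Rightarrow> 'a) \<Rightarrow> (nat \<Rightarrow> 'a) \<Rightarrow> ennreal" where
  "cone_lim d \<omega> r y z = ultralim \<omega> (\<lambda>n. ennreal (d (y n) (z n) / r n))"

definition cone_seqs ::
  "'a set \<Rightarrow> ('a \<Rightarrow> 'a \<Rightarrow> real) \<Rightarrow> nat filter \<Rightarrow> (nat \<Rightarrow> 'a) \<Rightarrow> (nat \<Rightarrow> real) \<Rightarrow> (nat \<Rightarrow> 'a) set" where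
  "cone_seqs M d \<omega> x r = {y. range y \<subseteq> M \<and> cone_lim d \<omega> r x y < \<infinity>}"

definition cone_rel ::
  "'a set \<Rightarrow> ('a \<Rightarrow> 'a \<Rightarrow> real) \<Rightarrow> nat filter \<Rightarrow> (nat \<Rightarrow> 'a) \<Rightarrow> (nat \<Rightarrow> real) \<Rightarrow> (nat \<Rightarrow> 'a) rel" where
  "cone_rel M d \<omega> x r =
     {(y, z). y \<in> cone_seqs M d \<omega> x r \<and> z \<in> cone_seqs M d \<omega> x r \<and> cone_lim d \<omega> r y z = 0}"

definition asymptotic_cone ::
  "'a set \<Rightarrow> ('a \<Rightarrow> 'a \<Rightarrow> real) \<Rightarrow> nat filter \<Rightarrow> (nat \<Rightarrow> 'a) \<Rightarrow> (nat \<Rightarrow> real) \<Rightarrow> (nat \<Rightarrow> 'a) set set" where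
  "asymptotic_cone M d \<omega> x r = cone_seqs M d \<omega> x r // cone_rel M d \<omega> x r"

text \<open>Independence of the chosen representatives is proved below (\<open>cone_dist_class\<close>).\<close>

definition cone_dist ::
  "('a \<Rightarrow> 'a \<Rightarrow> real) \<Rightarrow> nat filter \<Rightarrow> (nat \<Rightarrow> real) \<Rightarrow> (nat \<Rightarrow> 'a) set \<Rightarrow> (nat \<Rightarrow> 'a) set \<Rightarrow> real" where
  "cone_dist d \<omega> r Y Z = enn2real (cone_lim d \<omega> r (SOME y. y \<in> Y) (SOME z. z \<in> Z))"

subsection \<open>Well-definedness\<close>

lemma ultralim_eqI:
  assumes "ultrafilter \<omega>" "(a \<longlongrightarrow> l) \<omega>"
  shows "ultralim \<omega> a = l"
  using assms unfolding ultralim_def ultrafilter_def by (intro tendsto_Lim) auto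

lemma ultralim_tendsto:
  assumes u: "ultrafilter \<omega>"
  shows "(a \<longlongrightarrow> ultralim \<omega> a) \<omega>"
proof -
  let ?F = "filtermap a \<omega>"
  have "?F \<noteq> bot" using u by (simp add: ultrafilter_def filtermap_bot_iff)
  moreover have "compact (UNIV :: ennreal set)" by (rule compact_UNIV)
  ultimately obtain l where l: "inf (nhds l) ?F \<noteq> bot"
    unfolding compact_filter by fastforce
  have "(a \<longlongrightarrow> l) \<omega>"
  proof (rule topological_tendstoI)
    fix S :: "ennreal set" assume S: "open S" "l \<in> S"
    show "\<forall>\<^sub>F n in \<omega>. a n \<in> S"
    proof (rule ccontr)
      assume n: "\<not> (\<forall>\<^sub>F n in \<omega>. a n \<in> S)"
      have "eventually (\<lambda>n. n \<in> {n. a n \<in> S}) \<omega> \<or> eventually (\<lambda>n. n \<in> - {n. a n \<in> S}) \<omega>"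
        using u unfolding ultrafilter_def by blast
      with n have "eventually (\<lambda>n. a n \<notin> S) \<omega>" by simp
      then have "eventually (\<lambda>x. x \<notin> S) ?F" by (simp add: eventually_filtermap)
      moreover have "eventually (\<lambda>x. x \<in> S) (nhds l)" using S by (simp add: eventually_nhds) blast
      ultimately have "eventually (\<lambda>x. False) (inf (nhds l) ?F)"
        unfolding eventually_inf by blast
      with l show False by (simp add: trivial_limit_def)
    qed
  qed
  then show ?thesis using ultralim_eqI[OF u] by simp
qed

context Metric_space
begin

lemma cone_lim_commute: "cone_lim d \<omega> r y z = cone_lim d \<omega> r z y"
  by (simp add: cone_lim_def commute)

lemma cone_lim_triangle:
  assumes u: "ultrafilter \<omega>" and r: "\<forall>n. r n > 0"
    and M: "range y \<subseteq> M" "range z \<subseteq> M" "range w \<subseteq> M"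
  shows "cone_lim d \<omega> r y w \<le> cone_lim d \<omega> r y z + cone_lim d \<omega> r z w"
  unfolding cone_lim_def
proof (rule tendsto_le[OF _ tendsto_add[OF ultralim_tendsto[OF u] ultralim_tendsto[OF u]]
      ultralim_tendsto[OF u]])
  show "\<omega> \<noteq> bot" using u by (simp add: ultrafilter_def)
  have "ennreal (d (y n) (w n) / r n) \<le> ennreal (d (y n) (z n) / r n) + ennreal (d (z n) (w n) / r n)" for n
  proof -
    have "d (y n) (w n) \<le> d (y n) (z n) + d (z n) (w n)"
      using M by (intro triangle) auto
    then have "d (y n) (w n) / r n \<le> d (y n) (z n) / r n + d (z n) (w n) / r n"
      using r[rule_format, of n] by (simp add: divide_right_mono flip: add_divide_distrib)
    then show ?thesis
      using r[rule_format, of n] by (simp add: ennreal_leI flip: ennreal_plus)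
  qed
  then show "\<forall>\<^sub>F n in \<omega>. ennreal (d (y n) (w n) / r n)
      \<le> ennreal (d (y n) (z n) / r n) + ennreal (d (z n) (w n) / r n)"
    by simp
qed

lemma cone_lim_refl:
  assumes "ultrafilter \<omega>" "range y \<subseteq> M"
  shows "cone_lim d \<omega> r y y = 0"
proof -
  have "(\<lambda>n. ennreal (d (y n) (y n) / r n)) = (\<lambda>n. 0)"
    using assms(2) by (auto simp: image_subset_iff)
  then show ?thesis
    unfolding cone_lim_def using ultralim_eqI[OF assms(1) tendsto_const] by simp
qed

lemma cone_lim_finite:
  assumes u: "ultrafilter \<omega>" and r: "\<forall>n. r n > 0" and x: "range x \<subseteq> M"
    and "y \<in> cone_seqs M d \<omega> x r" "z \<in> cone_seqs M d \<omega> x r"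
  shows "cone_lim d \<omega> r y z < \<infinity>"
proof -
  have "cone_lim d \<omega> r y z \<le> cone_lim d \<omega> r x y + cone_lim d \<omega> r x z"
    unfolding cone_lim_commute[of \<omega> r x y]
    using assms(3-) by (intro cone_lim_triangle[OF u r]) (auto simp: cone_seqs_def)
  also have "\<dots> < \<infinity>" using assms by (simp add: cone_seqs_def)
  finally show ?thesis .
qed

lemma equiv_cone_rel:
  assumes u: "ultrafilter \<omega>" and r: "\<forall>n. r n > 0"
  shows "equiv (cone_seqs M d \<omega> x r) (cone_rel M d \<omega> x r)"
proof (rule equivI)
  show "cone_rel M d \<omega> x r \<subseteq> cone_seqs M d \<omega> x r \<times> cone_seqs M d \<omega> x r"
    by (auto simp: cone_rel_def)
  show "refl_on (cone_seqs M d \<omega> x r) (cone_rel M d \<omega> x r)"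
    using cone_lim_refl[OF u] by (auto simp: refl_on_def cone_rel_def cone_seqs_def)
  show "sym (cone_rel M d \<omega> x r)"
    by (rule symI) (simp add: cone_rel_def cone_lim_commute)
  show "trans (cone_rel M d \<omega> x r)"
  proof (rule transI)
    fix a b c assume h: "(a, b) \<in> cone_rel M d \<omega> x r" "(b, c) \<in> cone_rel M d \<omega> x r"
    then have "cone_lim d \<omega> r a c \<le> cone_lim d \<omega> r a b + cone_lim d \<omega> r b c"
      using r by (intro cone_lim_triangle[OF u]) (auto simp: cone_rel_def cone_seqs_def)
    with h show "(a, c) \<in> cone_rel M d \<omega> x r" by (auto simp: cone_rel_def)
  qed
qed

lemma cone_dist_class:
  assumes u: "ultrafilter \<omega>" and r: "\<forall>n. r n > 0" and x: "range x \<subseteq> M"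
    and Y: "Y \<in> asymptotic_cone M d \<omega> x r" "y \<in> Y"
    and Z: "Z \<in> asymptotic_cone M d \<omega> x r" "z \<in> Z"
  shows "ennreal (cone_dist d \<omega> r Y Z) = cone_lim d \<omega> r y z"
proof -
  note eq = equiv_cone_rel[OF u r, of x]
  define y' where "y' = (SOME y. y \<in> Y)"
  define z' where "z' = (SOME z. z \<in> Z)"
  have "y' \<in> Y" unfolding y'_def using Y(2) by (rule someI[of "\<lambda>y. y \<in> Y"])
  moreover have "z' \<in> Z" unfolding z'_def using Z(2) by (rule someI[of "\<lambda>z. z \<in> Z"])
  ultimately have yz: "(y, y') \<in> cone_rel M d \<omega> x r" "(z, z') \<in> cone_rel M d \<omega> x r"
    using quotient_eq_iff[OF eq Y(1)[unfolded asymptotic_cone_def] Y(1)[unfolded asymptotic_cone_def] Y(2)]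
      quotient_eq_iff[OF eq Z(1)[unfolded asymptotic_cone_def] Z(1)[unfolded asymptotic_cone_def] Z(2)]
    by simp_all
  have tri: "cone_lim d \<omega> r a e \<le> cone_lim d \<omega> r b f"
    if "(a, b) \<in> cone_rel M d \<omega> x r" "(f, e) \<in> cone_rel M d \<omega> x r" for a b e f
  proof -
    have "cone_lim d \<omega> r a e \<le> cone_lim d \<omega> r a b + cone_lim d \<omega> r b e"
      using that r by (intro cone_lim_triangle[OF u]) (auto simp: cone_rel_def cone_seqs_def)
    also have "cone_lim d \<omega> r b e \<le> cone_lim d \<omega> r b f + cone_lim d \<omega> r f e"
      using that r by (intro cone_lim_triangle[OF u]) (auto simp: cone_rel_def cone_seqs_def)
    finally show ?thesis using that by (auto simp: cone_rel_def add_left_mono)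
  qed
  have s: "sym (cone_rel M d \<omega> x r)" using eq by (simp add: equiv_def)
  have "cone_lim d \<omega> r y z = cone_lim d \<omega> r y' z'"
    using tri[OF yz(1) symD[OF s yz(2)]] tri[OF symD[OF s yz(1)] yz(2)] by (rule antisym)
  moreover have "cone_lim d \<omega> r y' z' < \<infinity>"
    using yz by (intro cone_lim_finite[OF u r x]) (auto simp: cone_rel_def)
  ultimately show ?thesis
    by (simp add: cone_dist_def y'_def z'_def)
qed

lemma Metric_space_cone:
  assumes u: "ultrafilter \<omega>" and r: "\<forall>n. r n > 0" and x: "range x \<subseteq> M"
  shows "Metric_space (asymptotic_cone M d \<omega> x r) (cone_dist d \<omega> r)"
proof
  note eq = equiv_cone_rel[OF u r, of x]
  have seqs: "y \<in> cone_seqs M d \<omega> x r" if "Y \<in> asymptotic_cone M d \<omega> x r" "y \<in> Y" for y Y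
    using in_quotient_imp_subset[OF eq that(1)[unfolded asymptotic_cone_def]] that(2) by (rule subsetD)
  have ne: "\<exists>y. y \<in> Y" if "Y \<in> asymptotic_cone M d \<omega> x r" for Y
    using in_quotient_imp_non_empty[OF eq that[unfolded asymptotic_cone_def]] by auto
  show nn: "0 \<le> cone_dist d \<omega> r Y Z" for Y Z by (simp add: cone_dist_def)
  show "cone_dist d \<omega> r Y Z = cone_dist d \<omega> r Z Y" for Y Z
    by (simp add: cone_dist_def cone_lim_commute)
  show "cone_dist d \<omega> r Y Z = 0 \<longleftrightarrow> Y = Z"
    if Y: "Y \<in> asymptotic_cone M d \<omega> x r" and Z: "Z \<in> asymptotic_cone M d \<omega> x r" for Y Z
  proof -
    obtain y z where yz: "y \<in> Y" "z \<in> Z" using ne[OF Y] ne[OF Z] by auto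
    have "cone_dist d \<omega> r Y Z = 0 \<longleftrightarrow> ennreal (cone_dist d \<omega> r Y Z) = 0"
      using nn[of Y Z] by (simp add: ennreal_eq_0_iff)
    also have "\<dots> \<longleftrightarrow> cone_lim d \<omega> r y z = 0"
      by (simp only: cone_dist_class[OF u r x Y yz(1) Z yz(2)])
    also have "\<dots> \<longleftrightarrow> (y, z) \<in> cone_rel M d \<omega> x r"
      using seqs[OF Y yz(1)] seqs[OF Z yz(2)] by (auto simp: cone_rel_def)
    also have "\<dots> \<longleftrightarrow> Y = Z"
      using quotient_eq_iff[OF eq Y[unfolded asymptotic_cone_def] Z[unfolded asymptotic_cone_def] yz] by simp
    finally show ?thesis .
  qed
  show "cone_dist d \<omega> r Y W \<le> cone_dist d \<omega> r Y Z + cone_dist d \<omega> r Z W"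
    if Y: "Y \<in> asymptotic_cone M d \<omega> x r" and Z: "Z \<in> asymptotic_cone M d \<omega> x r"
      and W: "W \<in> asymptotic_cone M d \<omega> x r" for Y Z W
  proof -
    obtain y z w where yz: "y \<in> Y" "z \<in> Z" "w \<in> W" using ne[OF Y] ne[OF Z] ne[OF W] by auto
    have "cone_lim d \<omega> r y w \<le> cone_lim d \<omega> r y z + cone_lim d \<omega> r z w"
      using seqs[OF Y yz(1)] seqs[OF Z yz(2)] seqs[OF W yz(3)] r by (intro cone_lim_triangle[OF u]) (auto simp: cone_seqs_def)
    then have "ennreal (cone_dist d \<omega> r Y W)
        \<le> ennreal (cone_dist d \<omega> r Y Z) + ennreal (cone_dist d \<omega> r Z W)"
      by (simp only: cone_dist_class[OF u r x Y yz(1) Z yz(2)]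
          cone_dist_class[OF u r x Z yz(2) W yz(3)] cone_dist_class[OF u r x Y yz(1) W yz(3)])
    then show ?thesis using nn by (simp flip: ennreal_plus add: ennreal_le_iff)
  qed
qed

end

end

theory Submission
  imports Defs
begin

text \<open>
  The bound on \<open>\<Omega>\<close> is equivalent to hyperbolicity; the conditions on cones and on detours follow from
  hyperbolicity, and each of them implies the bound on \<open>\<Omega>\<close>.

  The core is that the bound on \<open>\<Omega>\<close> implies hyperbolicity.  The bound gives that a triangle of perimeter
  \<open>P\<close> is \<open>P / 32 + C\<close>-thin for some constant \<open>C\<close>.  For a given perimeter, let \<open>R\<close> be the optimal Rips constant
  and let \<open>p\<close> be a point of a triangle that realises it.  All estimates are made up to additive
  constants, so that a contradiction arises once \<open>R\<close> is large.  First, a triangle with one side of length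
  \<open>a\<close> is \<open>4/5 * a\<close>-thin along its long sides, however long they are (\<open>thin_tail\<close>): at a point that is
  almost as far from the other sides as possible the triangle contains a quadrilateral whose size is
  controlled by its own thinness, and the linear bound for the two halves of that quadrilateral gives the
  estimate.  Hence the two long sides converge geometrically: a gap \<open>a\<close> shrinks by the factor \<open>11/20\<close>
  within the distance \<open>3/2 * a\<close> (\<open>tail_iterate\<close>).  Secondly, \<open>p\<close> must be near a centre
  of its triangle, that is a point that is \<open>R\<close>-close to both other sides (\<open>centre_exists\<close>).  Walking from
  there a distance of about \<open>3 * R\<close> towards each vertex one reaches points at which the sides are much
  closer to each other than \<open>R\<close>.  These points span a triangle of perimeter less than \<open>23 * R\<close>, so that
  \<open>p\<close>, which lies on one of its sides, is closer than \<open>R\<close> to the other two, by a definite fraction of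
  \<open>R\<close>.  As those stay close to the other two sides of the original triangle, this contradicts the choice
  of \<open>p\<close> (\<open>fat_triangle_bounded\<close>).

  Two sides of a triangle that avoid a ball around a point of the third one are a detour, so long detours
  make triangles thin.  Conversely, in a hyperbolic space repeated bisection shows that the length of a
  curve is at least exponential in the distance of the curve from a point of a geodesic with the same
  endpoints (\<open>chain_near_geodesic\<close>).

  If the bound on \<open>\<Omega>\<close> fails, rescaled fat triangles converge to a triangle of an asymptotic cone that is
  not degenerate, so the cone is not a real tree.  Conversely, a point of a hyperbolic space that almost
  lies between two others is close to every geodesic joining them (\<open>near_segment\<close>).  In the cone this shows that geodesics are
  unique and hence limits of geodesics of the space, and the Rips condition passes to the limit with
  constant \<open>0\<close>.
\<close>

section \<open>Geodesic segments\<close>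

context Metric_space
begin

abbreviation seg :: "'a \<Rightarrow> 'a \<Rightarrow> 'a set \<Rightarrow> bool" where
  "seg \<equiv> geodesic_between M d"

text \<open>
  The part of a geodesic \<open>l\<close> between two of its points, given by metric betweenness, so that the order
  of \<open>p\<close> and \<open>q\<close> along \<open>l\<close> does not matter.
\<close>

definition subseg :: "'a set \<Rightarrow> 'a \<Rightarrow> 'a \<Rightarrow> 'a set" where
  "subseg l p q = {w \<in> l. d p w + d w q = d p q}"

text \<open>The constant speed of a parametrisation is the distance of its endpoints.\<close>

lemma segE:
  assumes "seg x y l"
  obtains \<gamma> where "\<gamma> 0 = x" "\<gamma> 1 = y" "l = \<gamma> ` {0..1}" "l \<subseteq> M"
    "\<And>t s. t \<in> {0..1} \<Longrightarrow> s \<in> {0..1} \<Longrightarrow> d (\<gamma> t) (\<gamma> s) = d x y * \<bar>t - s\<bar>"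
proof -
  obtain \<gamma> k where g: "\<gamma> 0 = x" "\<gamma> 1 = y" "l = \<gamma> ` {0..1}" "l \<subseteq> M"
    and k: "\<forall>t\<in>{0..1}. \<forall>s\<in>{0..1}. d (\<gamma> t) (\<gamma> s) = k * \<bar>t - s\<bar>"
    using assms unfolding geodesic_between_def geodesic_map_def by blast
  have "d x y = k" using k[rule_format, of 0 1] g by simp
  with g k that show ?thesis by blast
qed

lemma segI:
  assumes "\<gamma> ` {0..1} \<subseteq> M" "k \<ge> 0" "\<gamma> 0 = x" "\<gamma> 1 = y" "l = \<gamma> ` {0..1}"
    "\<And>t s. t \<in> {0..1} \<Longrightarrow> s \<in> {0..1} \<Longrightarrow> d (\<gamma> t) (\<gamma> s) = k * \<bar>t - s\<bar>"
  shows "seg x y l"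
  using assms unfolding geodesic_between_def geodesic_map_def by blast

lemma seg_subset: "seg x y l \<Longrightarrow> l \<subseteq> M"
  by (elim segE)

lemma seg_ends: "seg x y l \<Longrightarrow> x \<in> l" "seg x y l \<Longrightarrow> y \<in> l"
  by (auto elim!: segE)

lemma seg_mem: "seg x y l \<Longrightarrow> x \<in> M" "seg x y l \<Longrightarrow> y \<in> M" "seg x y l \<Longrightarrow> p \<in> l \<Longrightarrow> p \<in> M"
  using seg_ends seg_subset by blast+

lemma seg_sym:
  assumes "seg x y l" shows "seg y x l"
proof -
  obtain \<gamma> where g: "\<gamma> 0 = x" "\<gamma> 1 = y" "l = \<gamma> ` {0..1}" "l \<subseteq> M"
    and k: "\<And>t s. t \<in> {0..1} \<Longrightarrow> s \<in> {0..1} \<Longrightarrow> d (\<gamma> t) (\<gamma> s) = d x y * \<bar>t - s\<bar>"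
    using segE[OF assms] by metis
  have im: "(\<lambda>t. 1 - t) ` {0..1} = {0..1::real}" by (auto intro!: image_eqI[of _ _ "1 - _"])
  have "l = (\<gamma> \<circ> (\<lambda>t. 1 - t)) ` {0..1}" unfolding image_comp[symmetric] im g(3) ..
  then show ?thesis
    by (intro segI[of "\<gamma> \<circ> (\<lambda>t. 1 - t)" "d x y"]) (use g k in \<open>auto simp: abs_minus_commute\<close>)
qed

lemma seg_dist:
  assumes "seg x y l" "p \<in> l" shows "d x p + d p y = d x y"
proof -
  obtain \<gamma> where g: "\<gamma> 0 = x" "\<gamma> 1 = y" "l = \<gamma> ` {0..1}" "l \<subseteq> M"
    and k: "\<And>t s. t \<in> {0..1} \<Longrightarrow> s \<in> {0..1} \<Longrightarrow> d (\<gamma> t) (\<gamma> s) = d x y * \<bar>t - s\<bar>"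
    using segE[OF assms(1)] by metis
  obtain t where t: "t \<in> {0..1}" "p = \<gamma> t" using g assms by blast
  show ?thesis using k[of 0 t] k[of t 1] t g by (simp add: algebra_simps)
qed

lemma seg_order:
  assumes "seg x y l" "p \<in> l" "q \<in> l" shows "d p q = \<bar>d x p - d x q\<bar>"
proof -
  obtain \<gamma> where g: "\<gamma> 0 = x" "\<gamma> 1 = y" "l = \<gamma> ` {0..1}" "l \<subseteq> M"
    and k: "\<And>t s. t \<in> {0..1} \<Longrightarrow> s \<in> {0..1} \<Longrightarrow> d (\<gamma> t) (\<gamma> s) = d x y * \<bar>t - s\<bar>"
    using segE[OF assms(1)] by metis
  obtain t s where t: "t \<in> {0..1}" "p = \<gamma> t" "s \<in> {0..1}" "q = \<gamma> s" using g assms by blast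
  have "d x p = d x y * t" "d x q = d x y * s"
    using k[of 0 t] k[of 0 s] t g by simp_all
  then show ?thesis using k[of t s] t
    by (simp add: abs_mult flip: right_diff_distrib)
qed

lemma seg_trivial:
  assumes "seg x x l" "q \<in> l" shows "q = x"
proof -
  have "d x q + d q x = 0" using seg_dist[OF assms] seg_mem[OF assms(1)] by simp
  then have "d x q = 0" using nonneg[of x q] nonneg[of q x] by linarith
  then show ?thesis using zero seg_mem[OF assms(1)] assms(2) by simp
qed

lemma seg_point:
  assumes "seg x y l" "0 \<le> s" "s \<le> d x y" obtains p where "p \<in> l" "d x p = s"
proof -
  obtain \<gamma> where g: "\<gamma> 0 = x" "\<gamma> 1 = y" "l = \<gamma> ` {0..1}" "l \<subseteq> M"
    and k: "\<And>t s. t \<in> {0..1} \<Longrightarrow> s \<in> {0..1} \<Longrightarrow> d (\<gamma> t) (\<gamma> s) = d x y * \<bar>t - s\<bar>"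
    using segE[OF assms(1)] by metis
  show ?thesis
  proof (cases "d x y = 0")
    case True
    with assms that[of x] seg_ends[OF assms(1)] seg_mem[OF assms(1)] show ?thesis by auto
  next
    case False
    then have "d x y > 0" by (simp add: order_less_le)
    then have t: "s / d x y \<in> {0..1}" using assms by auto
    show ?thesis
      using that[of "\<gamma> (s / d x y)"] k[of 0 "s / d x y"] g t False assms by auto
  qed
qed

lemma subseg_subset: "subseg l p q \<subseteq> l"
  by (auto simp: subseg_def)

lemma seg_subseg:
  assumes "seg x y l" "p \<in> l" "q \<in> l" shows "seg p q (subseg l p q)"
proof -
  obtain \<gamma> where g: "\<gamma> 0 = x" "\<gamma> 1 = y" "l = \<gamma> ` {0..1}" "l \<subseteq> M"
    and k: "\<And>t s. t \<in> {0..1} \<Longrightarrow> s \<in> {0..1} \<Longrightarrow> d (\<gamma> t) (\<gamma> s) = d x y * \<bar>t - s\<bar>"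
    using segE[OF assms(1)] by metis
  obtain a b where ab: "a \<in> {0..1}" "p = \<gamma> a" "b \<in> {0..1}" "q = \<gamma> b" using g assms by blast
  define \<eta> where "\<eta> = (\<lambda>t. \<gamma> (a + t * (b - a)))"
  have in01: "a + t * (b - a) \<in> {0..1}" if "t \<in> {0..1}" for t
  proof -
    have "a + t * (b - a) = (1 - t) * a + t * b" by (simp add: algebra_simps)
    then show ?thesis
      using convexD_alt[of "{0..1::real}" a b t] ab that by simp
  qed
  have dist: "d (\<eta> t) (\<eta> s) = d x y * \<bar>b - a\<bar> * \<bar>t - s\<bar>" if "t \<in> {0..1}" "s \<in> {0..1}" for t s
  proof -
    have "d (\<eta> t) (\<eta> s) = d x y * \<bar>(b - a) * (t - s)\<bar>"
      unfolding \<eta>_def using k[OF in01 in01, OF that] by (simp add: algebra_simps)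
    then show ?thesis by (simp add: abs_mult)
  qed
  have eq: "subseg l p q = \<eta> ` {0..1}"
  proof (intro equalityI subsetI)
    fix w assume "w \<in> \<eta> ` {0..1}"
    then obtain t where t: "t \<in> {0..1}" "w = \<eta> t" by blast
    have "p = \<eta> 0" "q = \<eta> 1" using ab by (simp_all add: \<eta>_def)
    then show "w \<in> subseg l p q"
      using dist[of 0 t] dist[of t 1] dist[of 0 1] t in01[OF t(1)] g(3)
      by (auto simp: subseg_def \<eta>_def algebra_simps)
  next
    fix w assume "w \<in> subseg l p q"
    then have w: "w \<in> l" "d p w + d w q = d p q" by (auto simp: subseg_def)
    then obtain c where c: "c \<in> {0..1}" "w = \<gamma> c" using g by blast
    have e: "d x y * (\<bar>a - c\<bar> + \<bar>c - b\<bar>) = d x y * \<bar>a - b\<bar>"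
      using w k[of a c] k[of c b] k[of a b] ab c by (simp add: algebra_simps)
    show "w \<in> \<eta> ` {0..1}"
    proof (cases "d x y = 0 \<or> a = b")
      case True
      have "d p w = 0"
        using True k[of a c] ab c e by (cases "d x y = 0") (auto)
      then have "w = p" using w g assms(2) by (metis subsetD zero)
      then show ?thesis using ab by (intro image_eqI[of _ _ 0]) (auto simp: \<eta>_def)
    next
      case False
      then have e': "\<bar>a - c\<bar> + \<bar>c - b\<bar> = \<bar>a - b\<bar>" using e by simp
      have "w = \<eta> ((c - a) / (b - a))" using False c by (simp add: \<eta>_def)
      moreover have "(c - a) / (b - a) \<in> {0..1}"
        using e' False by (auto simp: divide_simps split: if_splits)
      ultimately show ?thesis by blast
    qed
  qed
  show ?thesis
    by (rule segI[OF _ _ _ _ eq dist])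
       (use ab in01 g in \<open>auto simp: \<eta>_def\<close>)
qed

text \<open>
  Discrete connectedness of a geodesic: if each of its points has at least one of two properties and the
  endpoints have different ones, both properties hold within distance \<open>1\<close> of each other.
\<close>

lemma seg_switch:
  assumes l: "seg a b l" and PQ: "\<And>w. w \<in> l \<Longrightarrow> P w \<or> Q w" and "P a" "Q b"
  shows "\<exists>w\<in>l. \<exists>w'\<in>l. d w w' \<le> 1 \<and> P w \<and> Q w'"
proof (rule ccontr)
  assume no: "\<not> ?thesis"
  have "\<forall>w\<in>l. d a w \<le> real n \<longrightarrow> P w" for n
  proof (induction n)
    case 0
    show ?case
    proof (intro ballI impI)
      fix w assume "w \<in> l" "d a w \<le> real 0"
      then have "w = a" using seg_mem[OF l] nonneg[of a w] zero[of a w] by simp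
      then show "P w" using assms by simp
    qed
  next
    case (Suc n)
    show ?case
    proof (intro ballI impI)
      fix w assume w: "w \<in> l" "d a w \<le> real (Suc n)"
      have "d a w \<le> d a b" using seg_dist[OF l w(1)] nonneg[of w b] by linarith
      then obtain v where v: "v \<in> l" "d a v = max 0 (d a w - 1)"
        using seg_point[OF l, of "max 0 (d a w - 1)"] by auto
      then have "P v" using Suc w by auto
      moreover have "d v w \<le> 1" using seg_order[OF l v(1) w(1)] v nonneg[of a w] by auto
      ultimately show "P w" using no PQ w v by blast
    qed
  qed
  then have "P b" using seg_ends[OF l] real_arch_simple[of "d a b"] by blast
  then show False using no \<open>Q b\<close> seg_ends[OF l] seg_mem[OF l] by fastforce
qed

end

section \<open>Spaces whose triangles are thin compared with their perimeter\<close>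

text \<open>
  Geodesic spaces in which every triangle of perimeter \<open>P\<close> is \<open>P / 32 + C\<close>-thin.  The constant \<open>C\<close>
  absorbs the behaviour of small triangles.  Since the condition is required of all triangles, it is
  enough to state it for the points of the first side.
\<close>

locale linearly_thin = Metric_space M d
  for M :: "'a set" and d :: "'a \<Rightarrow> 'a \<Rightarrow> real" +
  fixes C :: real
  assumes C_nonneg: "C \<ge> 0"
    and seg_exists: "x \<in> M \<Longrightarrow> y \<in> M \<Longrightarrow> \<exists>l. geodesic_between M d x y l"
    and thin: "geodesic_between M d x y l1 \<Longrightarrow> geodesic_between M d y z l2 \<Longrightarrow>
      geodesic_between M d z x l3 \<Longrightarrow> p \<in> l1 \<Longrightarrow>
      \<exists>q\<in>l2 \<union> l3. d p q \<le> (d x y + d y z + d z x) / 32 + C"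
begin

text \<open>The additive error of the estimates for triangles with one short side.\<close>

abbreviation K :: real where "K \<equiv> 7 * C + 3"

text \<open>
  A quadrilateral is cut by a diagonal into two triangles; the perimeters of both are bounded in terms
  of three of the four sides.
\<close>

lemma quad_thin:
  assumes l: "seg A B l" and \<alpha>: "seg A A' \<alpha>" and \<beta>: "seg B B' \<beta>" and l': "seg A' B' l'"
    and p: "p \<in> l"
  shows "\<exists>q\<in>\<alpha> \<union> \<beta> \<union> l'. d p q \<le> (4 * d A B + 4 * d A A' + 2 * d B B') / 32 + 2 * C"
proof -
  note mem = seg_mem[OF l] seg_mem[OF \<alpha>] seg_mem[OF \<beta>] seg_mem[OF l']
  obtain \<epsilon> where \<epsilon>: "seg B A' \<epsilon>" using seg_exists mem by blast
  have ineq: "d B A' \<le> d A B + d A A'" "d A' B' \<le> d B A' + d B B'"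
    using mem triangle[of B A A'] triangle[of A' B B'] by (auto simp: commute)
  obtain v where v: "v \<in> \<epsilon> \<union> \<alpha>" "d p v \<le> (d A B + d B A' + d A' A) / 32 + C"
    using thin[OF l \<epsilon> seg_sym[OF \<alpha>] p] by blast
  show ?thesis
  proof (cases "v \<in> \<alpha>")
    case True
    have "d A B + d B A' + d A' A \<le> 4 * d A B + 4 * d A A' + 2 * d B B'"
      using ineq(1) nonneg[of A B] nonneg[of A A'] nonneg[of B B'] commute[of A' A] by linarith
    then have "d p v \<le> (4 * d A B + 4 * d A A' + 2 * d B B') / 32 + 2 * C"
      using v(2) C_nonneg by (simp add: field_simps)
    with True show ?thesis by blast
  next
    case False
    then have "v \<in> \<epsilon>" using v by blast
    then obtain q where q: "q \<in> \<beta> \<union> l'" "d v q \<le> (d A' B + d B B' + d B' A') / 32 + C"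
      using thin[OF seg_sym[OF \<epsilon>] \<beta> seg_sym[OF l']] by blast
    have "d p q \<le> d p v + d v q"
      using triangle mem p \<open>v \<in> \<epsilon>\<close> seg_mem[OF \<epsilon>] q by blast
    then have "d p q \<le> (4 * d A B + 4 * d A A' + 2 * d B B') / 32 + 2 * C"
      using v q ineq by (simp add: commute[of A' A] commute[of A' B] commute[of B' A'] field_simps)
    with q show ?thesis by blast
  qed
qed

text \<open>
  A point \<open>e\<close>-close to \<open>[B,B']\<close> but far from \<open>B\<close> is close to the part of \<open>[B,B']\<close> near \<open>B'\<close>.
\<close>

lemma leg_gap:
  assumes \<beta>: "seg B B' \<beta>" and p: "p \<in> M" and q: "q \<in> \<beta>" and e: "d p q \<le> e"
  shows "d p B' \<le> 2 * e + d B B' - d p B"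
proof -
  note mem = seg_mem[OF \<beta>]
  have "d p B' \<le> d p q + d q B'" "d p B \<le> d p q + d q B"
    using mem p q by (auto intro!: triangle)
  then show ?thesis using seg_dist[OF \<beta> q] e by (simp add: commute[of q B])
qed

text \<open>
  A quadrilateral with two opposite sides on the geodesics \<open>l\<close> and \<open>l'\<close>: a point \<open>p\<close> of the first is
  close to the second, because a short connecting side that it might be close to leads to \<open>l'\<close> as well.
  A degenerate connecting side gives no extra case.
\<close>

lemma quad_gap:
  assumes l: "seg x y l" "A \<in> l" "B \<in> l" "p \<in> subseg l A B"
    and l': "seg x' y' l'" "A' \<in> l'" "B' \<in> l'"
    and e: "(4 * d A B + 4 * d A A' + 2 * d B B') / 32 + 2 * C \<le> e"
  shows "\<exists>q\<in>l'. d p q \<le> e \<or> (A \<noteq> A' \<and> d p q \<le> 2 * e + d A A' - d p A)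
                        \<or> (B \<noteq> B' \<and> d p q \<le> 2 * e + d B B' - d p B)"
proof -
  have s: "seg A B (subseg l A B)" "seg A' B' (subseg l' A' B')"
    using l l' seg_subseg by blast+
  note mem = seg_mem[OF s(1)] seg_mem[OF s(2)]
  obtain \<alpha> \<beta> where ab: "seg A A' \<alpha>" "seg B B' \<beta>" using seg_exists mem by metis
  obtain q where q: "q \<in> \<alpha> \<union> \<beta> \<union> subseg l' A' B'" and
    "d p q \<le> (4 * d A B + 4 * d A A' + 2 * d B B') / 32 + 2 * C"
    using quad_thin[OF s(1) ab s(2) l(4)] by blast
  with e have pq: "d p q \<le> e" by linarith
  consider "q \<in> \<alpha>" | "q \<in> \<beta>" | "q \<in> l'" using q subseg_subset by blast
  then show ?thesis
  proof cases
    case 1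
    show ?thesis
    proof (cases "A = A'")
      case True
      then have "q = A'" using seg_trivial ab(1) 1 by blast
      then show ?thesis using pq l' by blast
    next
      case False
      then show ?thesis using leg_gap[OF ab(1) mem(3)[OF l(4)] 1 pq] l' by blast
    qed
  next
    case 2
    show ?thesis
    proof (cases "B = B'")
      case True
      then have "q = B'" using seg_trivial ab(2) 2 by blast
      then show ?thesis using pq l' by blast
    next
      case False
      then show ?thesis using leg_gap[OF ab(2) mem(3)[OF l(4)] 2 pq] l' by blast
    qed
  qed (use pq in blast)
qed

lemma subsegI:
  assumes l: "seg x y l" and "A \<in> l" "B \<in> l" "p \<in> l" "d x A \<le> d x p" "d x p \<le> d x B"
  shows "p \<in> subseg l A B"
  using assms(2-) seg_order[OF l, of A p] seg_order[OF l, of p B] seg_order[OF l, of A B]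
  by (auto simp: subseg_def)

text \<open>
  The point at distance \<open>k\<close> beyond \<open>p\<close> in the direction of \<open>x\<close>, replaced by \<open>x\<close> if it does not exist.
\<close>

lemma seg_shift:
  assumes l: "seg m x l" and p: "p \<in> l" and k: "k \<ge> 0"
  obtains B where "B \<in> l" "d m p \<le> d m B" "d p B \<le> k" "d p B = k \<or> B = x"
proof (cases "d m p + k \<le> d m x")
  case True
  then obtain B where B: "B \<in> l" "d m B = d m p + k"
    using seg_point[OF l, of "d m p + k"] k by auto
  then show ?thesis using that[of B] seg_order[OF l p B(1)] k by auto
next
  case False
  then show ?thesis
    using that[of x] seg_ends[OF l] seg_dist[OF l p] nonneg[of p x] by auto
qed

text \<open>
  The key estimate on long thin triangles.  If \<open>\<phi>\<close> is, up to \<open>1\<close>, the largest distance from a point of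
  \<open>l\<close> to the other two sides, and \<open>p\<close> nearly realises it, then \<open>p\<close> sits in a quadrilateral of size
  comparable with \<open>\<phi> + a\<close>, and the linear bound for this quadrilateral limits \<open>\<phi>\<close> in terms of \<open>a\<close>.
\<close>

lemma thin_side_near_sup:
  assumes b: "seg m m' b" and l: "seg m x l" and l': "seg m' x l'" and a: "d m m' \<le> a"
    and all: "\<And>q. q \<in> l \<Longrightarrow> \<exists>q'\<in>b \<union> l'. d q q' \<le> \<phi>"
    and p: "p \<in> l" and far: "\<And>q. q \<in> b \<union> l' \<Longrightarrow> d p q > \<phi> - 1"
  shows "\<phi> \<le> 4/5 * a + K"
proof (rule ccontr)
  assume "\<not> ?thesis"
  then have \<phi>: "\<phi> > 4/5 * a + K" by simp
  have a0: "a \<ge> 0" using a nonneg[of m m'] by linarith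
  \<comment> \<open>The margin \<open>k\<close> is at least \<open>2 * e + 1\<close>, where \<open>e\<close> bounds the distance from \<open>p\<close> to the other three
      sides of the quadrilateral.  So if \<open>p\<close> were \<open>e\<close>-close to a side of length at most \<open>\<phi>\<close> that
      connects \<open>l\<close> with \<open>l'\<close>, its distance to \<open>l'\<close> would be at most \<open>2 * e + \<phi> - k \<le> \<phi> - 1\<close>.\<close>
  define k where "k = a + 3/4 * \<phi> + 8 * C + 2"
  define e where "e = (8 * k + 8 * a + 6 * \<phi>) / 32 + 2 * C"
  have e: "2 * e + 1 \<le> k" "e \<le> \<phi> - 1"
    using \<phi> a0 C_nonneg by (auto simp: k_def e_def field_simps)
  have k0: "k \<ge> 0" using \<phi> a0 C_nonneg by (simp add: k_def)
  have pM: "p \<in> M" using p l seg_mem by blast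
  have base: "d p q \<le> d p m + a" if "q \<in> b" for q
  proof -
    have "d p q \<le> d p m + d m q" using seg_mem[OF b] that pM triangle by blast
    then show ?thesis using seg_dist[OF b that] a nonneg[of q m'] by linarith
  qed
  have m_far: "d p m > \<phi> - 1" using far seg_ends[OF b] by blast
  \<comment> \<open>On the side of \<open>x\<close> the corner at distance \<open>k\<close> is too far from \<open>b\<close>, so it is close to \<open>l'\<close>.\<close>
  obtain B where B: "B \<in> l" "d m p \<le> d m B" "d p B \<le> k" "d p B = k \<or> B = x"
    using seg_shift[OF l p k0] by blast
  obtain B' where B': "B' \<in> l'" "d B B' \<le> \<phi>" "d p B = k \<or> B = B'"
  proof (cases "B = x")
    case True
    then show ?thesis using that[of x] seg_ends[OF l'] seg_mem[OF l] \<phi> a0 C_nonneg by auto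
  next
    case False
    then have Bk: "d p B = k" using B by blast
    obtain B' where q: "B' \<in> b \<union> l'" "d B B' \<le> \<phi>" using all B by blast
    have "B' \<notin> b"
    proof
      assume Bb: "B' \<in> b"
      have "d m B \<le> d m B' + d B' B"
        using seg_mem[OF b] seg_mem[OF l] Bb B(1) triangle by blast
      then have "d m B \<le> a + \<phi>"
        using seg_dist[OF b Bb] a q nonneg[of B' m'] commute[of B' B] by linarith
      moreover have "d m B = d m p + k"
        using seg_order[OF l p B(1)] B Bk by auto
      ultimately show False using m_far \<phi> a0 C_nonneg by (simp add: k_def commute[of p m])
    qed
    then show ?thesis using that q Bk by blast
  qed
  obtain A where A: "A \<in> l" "d x p \<le> d x A" "d p A \<le> k" "d p A = k \<or> A = m"
    using seg_shift[OF seg_sym[OF l] p k0] by blast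
  have pos: "d m A \<le> d m p"
    using A seg_dist[OF l A(1)] seg_dist[OF l p] by (simp add: commute)
  have pAB: "p \<in> subseg l A B" by (rule subsegI[OF l A(1) B(1) p pos B(2)])
  have AB: "d A B = d p A + d p B" using pAB by (simp add: subseg_def commute)
  have B_leg: "d p B' \<le> \<phi> - 1" if "q \<in> \<beta>" "seg B B' \<beta>" "d p q \<le> e" for q \<beta>
  proof (cases "B = B'")
    case True
    then have "q = B'" using seg_trivial that by blast
    then show ?thesis using that(3) e by simp
  next
    case False
    then show ?thesis using leg_gap[OF that(2) pM that(1,3)] B' e by linarith
  qed
  \<comment> \<open>On the side of \<open>m\<close> either this works as well, or \<open>p\<close> is so close to \<open>m\<close> that \<open>m\<close> and \<open>m'\<close> serve
      as corners.\<close>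
  consider A' where "d p A = k" "A' \<in> l'" "d A A' \<le> \<phi>" | "d p m \<le> k + \<phi> + a"
  proof (cases "A = m")
    case True
    then show ?thesis using that A \<phi> a0 C_nonneg by auto
  next
    case False
    obtain q where q: "q \<in> b \<union> l'" "d A q \<le> \<phi>" using all A by blast
    show ?thesis
    proof (cases "q \<in> b")
      case True
      have "d p m \<le> d p A + d A m" "d A m \<le> d A q + d q m"
        using A(1) pM seg_mem[OF l] seg_mem[OF b] True by (auto intro!: triangle)
      then have "d p m \<le> k + \<phi> + a"
        using A q seg_dist[OF b True] nonneg[of q m'] a commute[of m q] by linarith
      then show ?thesis using that by blast
    next
      case False
      then show ?thesis using that q A \<open>A \<noteq> m\<close> by blast
    qed
  qed
  then show False
  proof cases
    case 1
    have "(4 * d A B + 4 * d A A' + 2 * d B B') / 32 + 2 * C \<le> e"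
      using AB A B B' 1 a0 by (simp add: e_def)
    then obtain q where "q \<in> l'" "d p q \<le> e \<or> d p q \<le> 2 * e + d A A' - d p A
        \<or> (B \<noteq> B' \<and> d p q \<le> 2 * e + d B B' - d p B)"
      using quad_gap[OF l A(1) B(1) pAB l' 1(2) B'(1)] by blast
    moreover have "d p q > \<phi> - 1" using far \<open>q \<in> l'\<close> by blast
    ultimately show False using 1 B' e by linarith
  next
    case 2
    have s: "seg m B (subseg l m B)" "seg m' B' (subseg l' m' B')"
      using l l' seg_subseg seg_ends B B' by blast+
    obtain \<beta> where \<beta>: "seg B B' \<beta>" using seg_exists seg_mem[OF s(1)] seg_mem[OF s(2)] by metis
    have "p \<in> subseg l m B"
      using B seg_mem[OF l] seg_ends[OF l] p by (intro subsegI[OF l]) auto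
    moreover have "d m B = d m p + d p B"
      using seg_order[OF l p B(1)] B by auto
    then have "(4 * d m B + 4 * d m m' + 2 * d B B') / 32 + 2 * C \<le> e"
      using 2 a B B' by (simp add: e_def commute[of m p])
    ultimately obtain q where q: "q \<in> b \<union> \<beta> \<union> subseg l' m' B'" "d p q \<le> e"
      using quad_thin[OF s(1) b \<beta> s(2)] by force
    show False
    proof (cases "q \<in> \<beta>")
      case True
      have "d p B' \<le> \<phi> - 1" using B_leg[OF True \<beta> q(2)] .
      then show False using far[of B'] B' by auto
    next
      case False
      then show False using q e far[of q] subseg_subset by fastforce
    qed
  qed
qed

end

text \<open>An upward closed set of reals that does not contain \<open>- 1\<close> has a boundary point up to \<open>1\<close>.\<close>

lemma exists_near_least:
  fixes P :: "real \<Rightarrow> bool"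
  assumes "P c" and mono: "\<And>x y. P x \<Longrightarrow> x \<le> y \<Longrightarrow> P y" and "\<not> P (- 1)"
  obtains \<phi> where "P \<phi>" "\<not> P (\<phi> - 1)" "\<phi> \<ge> 0"
proof -
  have ex: "\<exists>n. P (real n)" using assms(1) mono real_arch_simple[of c] by blast
  define n where "n = (LEAST n. P (real n))"
  have n: "P (real n)" unfolding n_def using ex by (rule LeastI_ex)
  have "\<not> P (real n - 1)"
  proof (cases n)
    case 0
    then show ?thesis using assms(3) by simp
  next
    case (Suc j)
    then have "\<not> P (real j)" using not_less_Least[of j "\<lambda>n. P (real n)"] by (simp add: n_def)
    then show ?thesis using Suc by simp
  qed
  then show ?thesis using that n by simp
qed

context linearly_thin
begin

text \<open>
  A triangle with a side of length at most \<open>a\<close> is \<open>4/5 * a + K\<close>-thin along its two other sides,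
  whatever their length.
\<close>

lemma thin_tail:
  assumes b: "seg m m' b" and l: "seg m x l" and l': "seg m' x l'" and a: "d m m' \<le> a"
    and p: "p \<in> l"
  shows "\<exists>q\<in>b \<union> l'. d p q \<le> 4/5 * a + K"
proof -
  define P where "P = (\<lambda>\<phi>. \<forall>p\<in>l. \<exists>q\<in>b \<union> l'. d p q \<le> \<phi>)"
  have "P ((d m x + d x m' + d m' m) / 32 + C)"
    unfolding P_def using thin[OF l seg_sym[OF l'] seg_sym[OF b]] by blast
  moreover have "\<not> P (- 1)"
    unfolding P_def using p by (smt (verit) nonneg)
  moreover have "P y" if "P x" "x \<le> y" for x y
    using that unfolding P_def by (meson order_trans)
  ultimately obtain \<phi> where \<phi>: "P \<phi>" "\<not> P (\<phi> - 1)" using exists_near_least by metis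
  then obtain p' where p': "p' \<in> l" "\<And>q. q \<in> b \<union> l' \<Longrightarrow> d p' q > \<phi> - 1"
    unfolding P_def by (meson not_le)
  have "\<phi> \<le> 4/5 * a + K"
    by (rule thin_side_near_sup[OF b l l' a _ p']) (use \<phi> in \<open>auto simp: P_def\<close>)
  then show ?thesis using \<phi> p unfolding P_def by (meson order_trans)
qed

end

section \<open>Convergence of the long sides of a thin triangle\<close>

text \<open>
  The descent along the two long sides of a triangle whose short side has length at most \<open>a\<close>: a step
  goes \<open>3/2 * a\<close> further and replaces \<open>a\<close> by \<open>11/20 * a + K\<close>.  After \<open>n\<close> steps the gap is at most
  \<open>tail_gap K n a\<close> and the distance covered is \<open>tail_reach K n a\<close>.
\<close>

primrec tail_gap :: "real \<Rightarrow> nat \<Rightarrow> real \<Rightarrow> real" where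
  "tail_gap K 0 a = a"
| "tail_gap K (Suc n) a = tail_gap K n (11/20 * a + K)"

primrec tail_reach :: "real \<Rightarrow> nat \<Rightarrow> real \<Rightarrow> real" where
  "tail_reach K 0 a = 0"
| "tail_reach K (Suc n) a = 3/2 * a + tail_reach K n (11/20 * a + K)"

lemma tail_reach_nonneg: "a \<ge> 0 \<Longrightarrow> K \<ge> 0 \<Longrightarrow> tail_reach K n a \<ge> 0"
  by (induction n arbitrary: a) auto

context linearly_thin
begin

text \<open>
  Moving \<open>3/2 * a\<close> away from the short side, the gap between the two long sides shrinks by a definite
  factor.  If the side ends before, the gap is closed at the common endpoint \<open>x\<close>.
\<close>

lemma tail_step:
  assumes l: "seg m x l" and l': "seg m' x l'" and a: "d m m' \<le> a" "a > 0"
    and w: "w \<in> l" "d m w = min (3/2 * a) (d m x)"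
  shows "\<exists>w'\<in>l'. d w w' \<le> 11/20 * a + K"
proof (cases "d m x \<le> 3/2 * a")
  case True
  then have "d w x = 0" using w seg_dist[OF l w(1)] by simp
  then show ?thesis using seg_ends[OF l'] a C_nonneg by (intro bexI[of _ x]) auto
next
  case False
  then have mw: "d m w = 3/2 * a" using w by simp
  obtain b where b: "seg m m' b" using seg_exists seg_mem[OF l] seg_mem[OF l'] by metis
  \<comment> \<open>A point of \<open>l\<close> at distance \<open>k\<close> beyond \<open>w\<close> is too far from \<open>b\<close> to be \<open>4/5 * a + K\<close>-close to it.\<close>
  define k where "k = 13/10 * a + K"
  have k0: "k \<ge> 0" using a C_nonneg by (simp add: k_def)
  obtain B where B: "B \<in> l" "d m w \<le> d m B" "d w B \<le> k" "d w B = k \<or> B = x"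
    using seg_shift[OF l w(1) k0] by blast
  have mB: "d m B = d m w + d w B" using seg_order[OF l w(1) B(1)] B by auto
  obtain B' where B': "B' \<in> l'" "d B B' \<le> 4/5 * a + K" "d w B = k \<or> B = B'"
  proof (cases "B = x")
    case True
    then show ?thesis using that[of x] seg_ends[OF l'] seg_mem[OF l] a C_nonneg by auto
  next
    case False
    then have Bk: "d w B = k" using B by blast
    obtain B' where q: "B' \<in> b \<union> l'" "d B B' \<le> 4/5 * a + K"
      using thin_tail[OF b l l' a(1) B(1)] by blast
    have "B' \<notin> b"
    proof
      assume Bb: "B' \<in> b"
      have "d m B \<le> d m B' + d B' B"
        using seg_mem[OF b] seg_mem[OF l] Bb B(1) triangle by blast
      then have "d m B \<le> a + (4/5 * a + K)"
        using seg_dist[OF b Bb] a q(2) nonneg[of B' m'] commute[of B' B] by linarith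
      then show False using mB mw Bk a by (simp add: k_def)
    qed
    then show ?thesis using that q Bk by blast
  qed
  define e where "e = 21/40 * a + K / 2"
  have "w \<in> subseg l m B"
    using B(1,2) seg_mem[OF l] seg_ends[OF l] w(1) by (intro subsegI[OF l]) auto
  moreover have "(4 * d m B + 4 * d m m' + 2 * d B B') / 32 + 2 * C \<le> e"
    using B B' mB mw a C_nonneg by (simp add: e_def k_def field_simps)
  ultimately obtain q where q: "q \<in> l'" "d w q \<le> e \<or> d w q \<le> 2 * e + d m m' - d w m
      \<or> (B \<noteq> B' \<and> d w q \<le> 2 * e + d B B' - d w B)"
    using quad_gap[OF l _ B(1) _ l' _ B'(1), of m w m'] seg_ends[OF l] seg_ends[OF l'] by blast
  have "d w q \<le> 11/20 * a + K"
    using q(2)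
  proof (elim disjE conjE)
    assume "d w q \<le> e"
    then show ?thesis using a C_nonneg by (simp add: e_def field_simps)
  next
    assume "d w q \<le> 2 * e + d m m' - d w m"
    then show ?thesis using a mw by (simp add: e_def field_simps commute[of w m])
  next
    assume "B \<noteq> B'" "d w q \<le> 2 * e + d B B' - d w B"
    then show ?thesis using B' C_nonneg by (simp add: e_def k_def field_simps)
  qed
  then show ?thesis using q by blast
qed

lemma tail_iterate:
  assumes "seg m x l" and "seg m' x l'" and "d m m' \<le> a" "a > 0"
    and "w \<in> l" "d m w = min (tail_reach K n a) (d m x)"
  shows "\<exists>w'\<in>l'. d w w' \<le> tail_gap K n a"
  using assms
proof (induction n arbitrary: m m' l l' a)
  case 0
  then have "d m w = 0" using nonneg[of m x] by simp
  then have "w = m" using 0 seg_mem[OF 0(1)] by simp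
  then show ?case using 0 seg_ends by auto
next
  case (Suc n)
  note l = Suc.prems(1) and l' = Suc.prems(2)
  define a' where "a' = 11/20 * a + K"
  have a': "a' > 0" using Suc.prems(4) C_nonneg by (simp add: a'_def)
  have r: "tail_reach K n a' \<ge> 0" using a' C_nonneg by (intro tail_reach_nonneg) auto
  obtain v where v: "v \<in> l" "d m v = min (3/2 * a) (d m x)"
    using seg_point[OF l, of "min (3/2 * a) (d m x)"] Suc.prems(4) by auto
  then obtain v' where v': "v' \<in> l'" "d v v' \<le> a'"
    using tail_step[OF l l' Suc.prems(3,4)] by (auto simp: a'_def)
  have mw: "d m w = min (3/2 * a + tail_reach K n a') (d m x)"
    using Suc.prems(6) by (simp add: a'_def)
  have le: "d m v \<le> d m w" "d m w \<le> d m x" using mw v r by auto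
  have s: "seg v x (subseg l v x)" "seg v' x (subseg l' v' x)"
    using seg_subseg l l' v v' seg_ends by blast+
  have "w \<in> subseg l v x"
    using l v Suc.prems le seg_ends[OF l] by (intro subsegI[OF l])
  moreover have "d v w = min (tail_reach K n a') (d v x)"
    using seg_order[OF l v(1) Suc.prems(5)] seg_order[OF l v(1) seg_ends(2)[OF l]] le v mw r
    by (auto simp: min_def split: if_splits)
  ultimately show ?case
    using Suc.IH[OF s v'(2) a'] subseg_subset[of l'] by (auto simp: a'_def)
qed

text \<open>
  A geodesic whose endpoints are \<open>g\<close>-close to \<open>l'\<close> stays close to \<open>l'\<close>: cut the quadrilateral into
  two triangles with a side of length at most \<open>g\<close>.
\<close>

lemma thin_strip:
  assumes s: "seg A B s" and l': "seg x y l'" "A' \<in> l'" "B' \<in> l'"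
    and g: "d A A' \<le> g" "d B B' \<le> g" and p: "p \<in> s"
  shows "\<exists>q\<in>l'. d p q \<le> 2 * (4/5 * g + K) + g"
proof -
  have s': "seg B' A' (subseg l' B' A')" using seg_subseg l' by blast
  note mem = seg_mem[OF s] seg_mem[OF s']
  obtain t \<alpha> \<beta> where t: "seg A' B t" and \<alpha>: "seg A A' \<alpha>" and \<beta>: "seg B B' \<beta>"
    using seg_exists mem by metis
  have g0: "g \<ge> 0" using g nonneg[of A A'] by linarith
  have near: "d q r \<le> g" if "seg q' r \<gamma>" "d q' r \<le> g" "q \<in> \<gamma>" for q q' r \<gamma>
    using seg_dist[OF that(1,3)] that(2) nonneg[of q' q] by linarith
  obtain v where v: "v \<in> \<alpha> \<union> t" "d p v \<le> 4/5 * g + K"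
    using thin_tail[OF \<alpha> s t g(1) p] by blast
  show ?thesis
  proof (cases "v \<in> \<alpha>")
    case True
    have "d p A' \<le> d p v + d v A'" using True seg_mem[OF \<alpha>] mem(3)[OF p] triangle by blast
    then have "d p A' \<le> 2 * (4/5 * g + K) + g"
      using near[OF \<alpha> g(1) True] v(2) g0 C_nonneg by (simp add: field_simps)
    then show ?thesis using l' by blast
  next
    case False
    then have vt: "v \<in> t" using v by blast
    obtain q where q: "q \<in> \<beta> \<union> subseg l' B' A'" "d v q \<le> 4/5 * g + K"
      using thin_tail[OF \<beta> seg_sym[OF t] s' g(2) vt] by blast
    have pM: "p \<in> M" "v \<in> M" "q \<in> M" "B' \<in> M"
      using mem p seg_mem[OF t] vt q seg_mem[OF \<beta>] by blast+
    have pq: "d p q \<le> d p v + d v q" "d p B' \<le> d p q + d q B'" using triangle pM by auto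
    show ?thesis
    proof (cases "q \<in> \<beta>")
      case True
      then have "d p B' \<le> 2 * (4/5 * g + K) + g"
        using pq v q near[OF \<beta> g(2) True] by (simp add: field_simps)
      then show ?thesis using l' by blast
    next
      case False
      then have "q \<in> l'" using q subseg_subset by blast
      moreover have "d p q \<le> 2 * (4/5 * g + K) + g"
        using pq v q g0 by (simp add: field_simps)
      ultimately show ?thesis by blast
    qed
  qed
qed

end

section \<open>Fat triangles\<close>

context linearly_thin
begin

text \<open>
  In a triangle with \<open>R\<close>-close sides, a point at distance almost \<open>R\<close> from the two other sides is close
  to a point \<open>m\<close> that is about \<open>R\<close>-close to both of them: otherwise a neighbourhood of \<open>p\<close> would run
  along a single side, which is impossible by the estimate for quadrilaterals.
\<close>

lemma centre_exists:
  assumes l1: "seg x y l1" and l2: "seg y z l2" and l3: "seg z x l3"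
    and near: "\<And>w. w \<in> l1 \<Longrightarrow> \<exists>q\<in>l2 \<union> l3. d w q \<le> R"
    and p: "p \<in> l1" and far: "\<And>q. q \<in> l2 \<union> l3 \<Longrightarrow> d p q > R - 1"
    and R: "R > 40 * K"
  obtains m m2 m3 where "m \<in> l1" "d p m \<le> 3/4 * R + 8 * C + 2" "m2 \<in> l2" "m3 \<in> l3"
    "d m m2 \<le> R + 1" "d m m3 \<le> R + 1"
proof -
  note result = that
  define k where "k = 3/4 * R + 8 * C + 2"
  have k: "k \<ge> 0" "k \<le> R - 1" using R C_nonneg by (auto simp: k_def)
  obtain V where V: "V \<in> l1" "d x p \<le> d x V" "d p V \<le> k" "d p V = k \<or> V = y"
    using seg_shift[OF l1 p k(1)] by blast
  obtain U where U: "U \<in> l1" "d y p \<le> d y U" "d p U \<le> k" "d p U = k \<or> U = x"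
    using seg_shift[OF seg_sym[OF l1] p k(1)] by blast
  have "V \<noteq> y" using far[of y] seg_ends[OF l2] V k by auto
  then have Vk: "d p V = k" using V by blast
  have "U \<noteq> x" using far[of x] seg_ends[OF l3] U k by auto
  then have Uk: "d p U = k" using U by blast
  have "d x U \<le> d x p" using seg_dist[OF l1 U(1)] seg_dist[OF l1 p] U(2) by (simp add: commute)
  then have pUV: "p \<in> subseg l1 U V" using subsegI[OF l1 U(1) V(1) p] V by blast
  have UV: "d U V = 2 * k" using pUV Uk Vk by (simp add: subseg_def commute)
  have s: "seg U V (subseg l1 U V)" using seg_subseg l1 U V by blast
  have sub: "w \<in> l1" "d p w \<le> k" if "w \<in> subseg l1 U V" for w
  proof -
    show "w \<in> l1" using that subseg_subset by blast
    have "d U p = k" using Uk commute[of U p] by simp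
    then show "d p w \<le> k"
      using seg_order[OF s pUV that] seg_dist[OF s that] UV nonneg[of U w] nonneg[of w V]
      by linarith
  qed
  define N2 where "N2 = (\<lambda>w. \<exists>q\<in>l2. d w q \<le> R)"
  define N3 where "N3 = (\<lambda>w. \<exists>q\<in>l3. d w q \<le> R)"
  have N: "N2 w \<or> N3 w" if "w \<in> l1" for w using near[OF that] by (auto simp: N2_def N3_def)
  have both: thesis if ww: "w \<in> subseg l1 U V" "w' \<in> subseg l1 U V" "d w w' \<le> 1" "N2 w" "N3 w'" for w w'
  proof -
    obtain m2 m3 where m: "m2 \<in> l2" "d w m2 \<le> R" "m3 \<in> l3" "d w' m3 \<le> R"
      using ww by (auto simp: N2_def N3_def)
    have M: "w \<in> M" "w' \<in> M" "m3 \<in> M"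
      using sub ww m seg_mem(3)[OF l1] seg_mem(3)[OF l3] by blast+
    have "d w m3 \<le> R + 1" using triangle[OF M] m(4) ww(3) by linarith
    moreover have "d w m2 \<le> R + 1" "d p w \<le> k" using m(2) sub(2)[OF ww(1)] by simp_all
    ultimately show ?thesis using result[OF sub(1)[OF ww(1)] _ m(1,3)] unfolding k_def by blast
  qed
  have same: False if H: "seg x' y' l'" "A' \<in> l'" "B' \<in> l'" "d U A' \<le> R" "d V B' \<le> R" "l' \<subseteq> l2 \<union> l3"
    for x' y' l' A' B'
  proof -
    define e where "e = (8 * k + 6 * R) / 32 + 2 * C"
    have e: "2 * e + 1 \<le> k" "e \<le> R - 1" using R C_nonneg by (auto simp: k_def e_def field_simps)
    have "(4 * d U V + 4 * d U A' + 2 * d V B') / 32 + 2 * C \<le> e"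
      using UV H by (simp add: e_def)
    then obtain q where q: "q \<in> l'" "d p q \<le> e \<or> d p q \<le> 2 * e + d U A' - d p U
        \<or> d p q \<le> 2 * e + d V B' - d p V"
      using quad_gap[OF l1 U(1) V(1) pUV H(1-3)] by blast
    then have "d p q > R - 1" using far H by blast
    then show False using q H Uk Vk e by linarith
  qed
  show ?thesis
  proof (cases "N2 U")
    case True
    then have "N3 V" using N[OF V(1)] same[OF l2] by (auto simp: N2_def)
    then obtain w w' where "w \<in> subseg l1 U V" "w' \<in> subseg l1 U V" "d w w' \<le> 1" "N2 w" "N3 w'"
      using seg_switch[OF s, of N2 N3] N sub True by blast
    then show ?thesis by (rule both)
  next
    case False
    then have "N3 U" using N[OF U(1)] by blast
    then have "N2 V" using N[OF V(1)] same[OF l3] by (auto simp: N3_def)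
    then obtain w w' where "w \<in> subseg l1 U V" "w' \<in> subseg l1 U V" "d w w' \<le> 1" "N3 w" "N2 w'"
      using seg_switch[OF s, of N3 N2] N sub \<open>N3 U\<close> by blast
    then show ?thesis using both[of w' w] by (simp add: commute)
  qed
qed

text \<open>
  If \<open>R\<close> is, up to \<open>1\<close>, the optimal constant for the triangles of perimeter at most \<open>T\<close>, then it is
  bounded independently of \<open>T\<close>.  Starting from a point \<open>m\<close> and a point \<open>u\<close> between the sides, one walks
  a distance of about \<open>3 * R\<close> towards each of the vertices, until the gap between the sides has shrunk to
  less than \<open>R / 10\<close>.  The points \<open>X\<close>, \<open>Y\<close>, \<open>Z\<close> reached span a triangle of perimeter less than
  \<open>23 * R\<close> (all up to additive constants), whose sides run close to those of the original triangle.
\<close>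

lemma fat_triangle_bounded:
  assumes near: "\<And>x y z l1 l2 l3 w. seg x y l1 \<Longrightarrow> seg y z l2 \<Longrightarrow> seg z x l3 \<Longrightarrow>
      d x y + d y z + d z x \<le> T \<Longrightarrow> w \<in> l1 \<Longrightarrow> \<exists>q\<in>l2 \<union> l3. d w q \<le> R"
    and l1: "seg x y l1" and l2: "seg y z l2" and l3: "seg z x l3"
    and per: "d x y + d y z + d z x \<le> T"
    and p: "p \<in> l1" and far: "\<And>q. q \<in> l2 \<union> l3 \<Longrightarrow> d p q > R - 1"
  shows "R \<le> 200 * K"
proof (rule ccontr)
  assume "\<not> ?thesis"
  then have R: "R > 200 * K" by simp
  have R40: "R > 40 * K" using R C_nonneg by simp
  obtain m m2 m3 where m: "m \<in> l1" "d p m \<le> 3/4 * R + 8 * C + 2" "m2 \<in> l2" "m3 \<in> l3"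
    "d m m2 \<le> R + 1" "d m m3 \<le> R + 1"
    using centre_exists[OF l1 l2 l3 near[OF l1 l2 l3 per] p far R40] by blast
  have M: "x \<in> M" "y \<in> M" "z \<in> M" "m \<in> M" "m2 \<in> M" "m3 \<in> M" "p \<in> M"
    using seg_mem[OF l1] seg_mem[OF l2] seg_mem[OF l3] m p by blast+
  \<comment> \<open>A point \<open>u\<close> on a geodesic \<open>[m3,m2]\<close> that is close to both \<open>[z,m3]\<close> and \<open>[m2,z]\<close>.\<close>
  have s3: "seg z m3 (subseg l3 z m3)" and s2: "seg m2 z (subseg l2 m2 z)"
    using seg_subseg l3 l2 seg_ends m by blast+
  obtain c where c: "seg m3 m2 c" using seg_exists M by blast
  have "d m3 m2 \<le> d m3 x + d x y + d y m2"
    using triangle[of m3 x m2] triangle[of x y m2] M by linarith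
  then have "d m3 m2 + d m2 z + d z m3 \<le> T"
    using per seg_dist[OF l2 m(3)] seg_dist[OF l3 m(4)] by (simp add: commute)
  then have near_c: "\<exists>q\<in>subseg l2 m2 z \<union> subseg l3 z m3. d w q \<le> R" if "w \<in> c" for w
    using near[OF c s2 s3] that by blast
  have ends: "\<exists>q\<in>subseg l3 z m3. d m3 q \<le> R" "\<exists>q\<in>subseg l2 m2 z. d m2 q \<le> R"
    using seg_ends(2)[OF s3] seg_ends(1)[OF s2] M R C_nonneg
    by (auto intro: bexI[of _ m3] bexI[of _ m2])
  obtain u u' where u: "u \<in> c" "u' \<in> c" "d u u' \<le> 1"
      "\<exists>q\<in>subseg l3 z m3. d u q \<le> R" "\<exists>q\<in>subseg l2 m2 z. d u' q \<le> R"
    using seg_switch[OF c, of "\<lambda>w. \<exists>q\<in>subseg l3 z m3. d w q \<le> R" "\<lambda>w. \<exists>q\<in>subseg l2 m2 z. d w q \<le> R"]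
      near_c ends by blast
  obtain u3 u2 where u3: "u3 \<in> l3" "d u u3 \<le> R + 1" and u2: "u2 \<in> l2" "d u' u2 \<le> R"
    using u(4,5) subseg_subset by fastforce
  have uM: "u \<in> M" "u' \<in> M" "u3 \<in> M" "u2 \<in> M"
    using u u2 u3 seg_mem[OF c] seg_mem[OF l2] seg_mem[OF l3] by blast+
  have uu2: "d u u2 \<le> R + 1" using triangle[of u u' u2] uM u u2 by linarith
  have um: "d u m \<le> 2 * R + 2"
  proof -
    have "d m3 u + d u m2 = d m3 m2" using seg_dist[OF c u(1)] .
    moreover have "d m3 m2 \<le> d m3 m + d m m2" "d u m \<le> d u m3 + d m3 m" "d u m \<le> d u m2 + d m2 m"
      using triangle M uM by blast+
    ultimately show ?thesis using m commute[of m3 m] commute[of u m3] commute[of m2 m] by linarith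
  qed
  define a where "a = R + 1"
  have a: "a > 0" using R C_nonneg by (simp add: a_def)
  \<comment> \<open>Four steps suffice for the sum of all errors to stay below \<open>R\<close>.\<close>
  define S where "S = tail_reach K 4 a"
  define g where "g = tail_gap K 4 a"
  have S: "S \<le> 303/100 * a + 7 * K" "3/2 * a \<le> S"
    using a C_nonneg by (simp_all add: S_def eval_nat_numeral field_simps)
  have g: "g \<le> 92/1000 * a + 3 * K"
    using a C_nonneg by (simp add: g_def eval_nat_numeral field_simps)
  \<comment> \<open>The point reached depends on \<open>l\<close> only, so on \<open>[u,z]\<close> one point serves both sides through \<open>z\<close>.\<close>
  have tail: "\<exists>w\<in>l. d o' w = min S (d o' v) \<and>
      (\<forall>o'' l'. seg o'' v l' \<longrightarrow> d o' o'' \<le> a \<longrightarrow> (\<exists>w'\<in>l'. d w w' \<le> g))"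
    if l: "seg o' v l" for o' v l
  proof -
    obtain w where "w \<in> l" "d o' w = min S (d o' v)"
      using seg_point[OF l, of "min S (d o' v)"] S a by auto
    then show ?thesis
      using tail_iterate[OF l _ _ a, of _ _ w 4] unfolding S_def g_def by blast
  qed
  have sx: "seg m x (subseg l1 m x)" and sy: "seg m y (subseg l1 m y)"
    using seg_subseg l1 seg_ends m by blast+
  obtain \<zeta> where sz: "seg u z \<zeta>" using seg_exists uM M by blast
  obtain X where X: "X \<in> subseg l1 m x" "d m X = min S (d m x)"
    "\<And>o'' l'. seg o'' x l' \<Longrightarrow> d m o'' \<le> a \<Longrightarrow> \<exists>w'\<in>l'. d X w' \<le> g"
    using tail[OF sx] by metis
  obtain Y where Y: "Y \<in> subseg l1 m y" "d m Y = min S (d m y)"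
    "\<And>o'' l'. seg o'' y l' \<Longrightarrow> d m o'' \<le> a \<Longrightarrow> \<exists>w'\<in>l'. d Y w' \<le> g"
    using tail[OF sy] by metis
  obtain Z where Z: "Z \<in> \<zeta>" "d u Z = min S (d u z)"
    "\<And>o'' l'. seg o'' z l' \<Longrightarrow> d u o'' \<le> a \<Longrightarrow> \<exists>w'\<in>l'. d Z w' \<le> g"
    using tail[OF sz] by metis
  have XY: "X \<in> l1" "Y \<in> l1" "X \<in> M" "Y \<in> M" "Z \<in> M"
    using X Y Z subseg_subset seg_mem[OF l1] seg_mem[OF sz] by blast+
  obtain X' where X': "X' \<in> l3" "d X X' \<le> g"
    using X(3)[OF seg_subseg[OF l3 m(4)]] m seg_ends[OF l3] subseg_subset unfolding a_def by blast
  obtain Y' where Y': "Y' \<in> l2" "d Y Y' \<le> g"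
    using Y(3)[OF seg_subseg[OF l2 m(3)]] m seg_ends[OF l2] subseg_subset unfolding a_def by blast
  obtain Z3 where Z3: "Z3 \<in> l3" "d Z Z3 \<le> g"
    using Z(3)[OF seg_subseg[OF l3 u3(1)]] u3 seg_ends[OF l3] subseg_subset unfolding a_def by blast
  obtain Z2 where Z2: "Z2 \<in> l2" "d Z Z2 \<le> g"
    using Z(3)[OF seg_subseg[OF l2 u2(1)]] uu2 seg_ends[OF l2] subseg_subset unfolding a_def by blast
  have pm: "\<bar>d x p - d x m\<bar> \<le> S"
    using seg_order[OF l1 p m(1)] m(2) S R C_nonneg by (simp add: a_def)
  have dX: "d x X \<le> d x p"
  proof -
    have "d m x = d x m" "d m X + d X x = d m x" "d X x = d x X"
      using seg_dist[OF sx X(1)] commute by auto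
    moreover have "d m X = S \<or> d m X = d m x" using X(2) by linarith
    ultimately show ?thesis using pm nonneg[of x p] by linarith
  qed
  have dY: "d x p \<le> d x Y"
  proof -
    have "d x m + d m y = d x y" "d x Y + d Y y = d x y" "d x p + d p y = d x y"
      "d m Y + d Y y = d m y"
      using seg_dist[OF l1 m(1)] seg_dist[OF l1 XY(2)] seg_dist[OF l1 p] seg_dist[OF sy Y(1)]
      by blast+
    moreover have "d m Y = S \<or> d m Y = d m y" using Y(2) by linarith
    ultimately show ?thesis using pm nonneg[of p y] by linarith
  qed
  have pXY: "p \<in> subseg l1 X Y" by (rule subsegI[OF l1 XY(1,2) p dX dY])
  obtain \<beta> \<alpha> where t: "seg Y Z \<beta>" "seg Z X \<alpha>" using seg_exists XY by metis
  have le: "d X Y \<le> 2 * S" "d Y Z \<le> 2 * S + 2 * R + 2" "d Z X \<le> 2 * S + 2 * R + 2"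
  proof -
    have "d m X \<le> S" "d m Y \<le> S" "d u Z \<le> S" using X Y Z by simp_all
    moreover have "d X Y \<le> d X m + d m Y" "d Y Z \<le> d Y m + d m Z" "d Z X \<le> d Z m + d m X"
      "d m Z \<le> d m u + d u Z" "d Z m \<le> d Z u + d u m"
      using triangle M uM XY by blast+
    ultimately show "d X Y \<le> 2 * S" "d Y Z \<le> 2 * S + 2 * R + 2" "d Z X \<le> 2 * S + 2 * R + 2"
      using um commute[of X m] commute[of Y m] commute[of m u] commute[of Z u] by linarith+
  qed
  obtain v where v: "v \<in> \<beta> \<union> \<alpha>" "d p v \<le> (d X Y + d Y Z + d Z X) / 32 + C"
    using thin[OF seg_subseg[OF l1 XY(1,2)] t pXY] by blast
  have pv: "d p v \<le> (6 * S + 4 * R + 4) / 32 + C" using v(2) le by (simp add: field_simps)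
  obtain q where q: "q \<in> l2 \<union> l3" "d v q \<le> 2 * (4/5 * g + K) + g"
    using v(1) thin_strip[OF t(1) l2 Y'(1) Z2(1) Y'(2) Z2(2)]
      thin_strip[OF t(2) l3 Z3(1) X'(1) Z3(2) X'(2)] by blast
  have "v \<in> M" "q \<in> M" using v q seg_mem[OF t(1)] seg_mem[OF t(2)] seg_mem[OF l2] seg_mem[OF l3] by blast+
  then have "d p q \<le> d p v + d v q" using triangle M by blast
  then have "d p q \<le> R - 1"
    using pv q(2) S g R C_nonneg by (simp add: a_def field_simps)
  then show False using far[OF q(1)] by linarith
qed

end

section \<open>The Rips condition and the function \<open>\<Omega>\<close>\<close>

context Metric_space
begin

lemma dist_to_set_bdd: "bdd_below ((\<lambda>a. d p a) ` A)"
  by (rule bdd_belowI[of _ 0]) auto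

lemma dist_to_set_lower: "A \<noteq> {} \<Longrightarrow> (\<And>a. a \<in> A \<Longrightarrow> c \<le> d p a) \<Longrightarrow> c \<le> dist_to_set d p A"
  unfolding dist_to_set_def by (intro cINF_greatest) auto

lemma dist_to_set_le: "a \<in> A \<Longrightarrow> dist_to_set d p A \<le> d p a"
  unfolding dist_to_set_def using dist_to_set_bdd by (rule cINF_lower)

lemma dist_to_set_less:
  assumes "A \<noteq> {}" "dist_to_set d p A < c" obtains a where "a \<in> A" "d p a < c"
  using assms dist_to_set_bdd unfolding dist_to_set_def by (auto simp: cINF_less_iff)

lemma rips_mono: "rips d \<delta> l1 l2 l3 \<Longrightarrow> \<delta> \<le> \<delta>' \<Longrightarrow> rips d \<delta>' l1 l2 l3"
  unfolding rips_def by (meson order_trans)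

lemma triangle_rotate: "triangle_in M d x y z l1 l2 l3 \<Longrightarrow> triangle_in M d y z x l2 l3 l1"
  by (simp add: triangle_in_def)

text \<open>
  A class of triangles closed under rotation satisfies the Rips condition as soon as the points of the
  first side do.
\<close>

lemma rips_if_first_sides:
  assumes t: "triangle_in M d x y z l1 l2 l3" and P: "P x y z"
    and rot: "\<And>x y z. P x y z \<Longrightarrow> P y z x"
    and first: "\<And>x y z l1 l2 l3 p. P x y z \<Longrightarrow> triangle_in M d x y z l1 l2 l3 \<Longrightarrow> p \<in> l1 \<Longrightarrow>
      \<exists>q\<in>l2 \<union> l3. d p q \<le> \<delta>"
  shows "rips d \<delta> l1 l2 l3"
proof -
  have *: "\<forall>p\<in>l1. dist_to_set d p (l2 \<union> l3) \<le> \<delta>"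
    if "P x y z" "triangle_in M d x y z l1 l2 l3" for x y z l1 l2 l3
    using first[OF that] dist_to_set_le by (meson order_trans)
  note t2 = triangle_rotate[OF t] and t3 = triangle_rotate[OF triangle_rotate[OF t]]
  show ?thesis
    using *[OF P t] *[OF rot[OF P] t2] *[OF rot[OF rot[OF P]] t3]
    by (simp add: rips_def Un_commute)
qed

lemma rips_near:
  assumes "rips d \<delta> l1 l2 l3" "l2 \<noteq> {}" "p \<in> l1" "\<delta> < c"
  obtains q where "q \<in> l2 \<union> l3" "d p q < c"
  using assms dist_to_set_less[of "l2 \<union> l3" p c] unfolding rips_def by force

lemma rips_nonneg:
  assumes t: "triangle_in M d x y z l1 l2 l3" and r: "rips d \<delta> l1 l2 l3"
  shows "\<delta> \<ge> 0"
proof -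
  have "x \<in> l1" "y \<in> l2" using t seg_ends unfolding triangle_in_def by blast+
  then have "0 \<le> dist_to_set d x (l2 \<union> l3)" "dist_to_set d x (l2 \<union> l3) \<le> \<delta>"
    using r by (auto simp: rips_def intro!: dist_to_set_lower)
  then show ?thesis by linarith
qed

lemma rips_perimeter:
  assumes t: "triangle_in M d x y z l1 l2 l3" shows "rips d (perimeter d x y z) l1 l2 l3"
proof (rule rips_if_first_sides[OF t, of "\<lambda>a b c. perimeter d a b c = perimeter d x y z"])
  fix a b c k1 k2 k3 p
  assume p: "perimeter d a b c = perimeter d x y z" "triangle_in M d a b c k1 k2 k3" "p \<in> k1"
  then have k: "seg a b k1" "seg b c k2" "seg c a k3" by (auto simp: triangle_in_def)
  have "d p b \<le> perimeter d a b c"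
    unfolding perimeter_def using seg_dist[OF k(1) p(3)]
      nonneg[of a p] nonneg[of b c] nonneg[of c a] by linarith
  then have "d p b \<le> perimeter d x y z" using p(1) by simp
  then show "\<exists>q\<in>k2 \<union> k3. d p q \<le> perimeter d x y z" using seg_ends[OF k(2)] by blast
qed (auto simp: perimeter_def)

lemma triangle_delta_le:
  assumes "triangle_in M d x y z l1 l2 l3" "rips d \<delta> l1 l2 l3"
  shows "triangle_delta d l1 l2 l3 \<le> \<delta>"
  unfolding triangle_delta_def using assms rips_nonneg by (intro cInf_lower bdd_belowI[of _ 0]) auto

lemma rips_above_triangle_delta:
  assumes "triangle_in M d x y z l1 l2 l3" "triangle_delta d l1 l2 l3 < c"
  shows "rips d c l1 l2 l3"
proof -
  have "{\<delta>. rips d \<delta> l1 l2 l3} \<noteq> {}" using rips_perimeter[OF assms(1)] by blast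
  moreover have "bdd_below {\<delta>. rips d \<delta> l1 l2 l3}"
    using rips_nonneg[OF assms(1)] by (intro bdd_belowI[of _ 0]) auto
  ultimately obtain \<delta> where "rips d \<delta> l1 l2 l3" "\<delta> < c"
    using assms(2) unfolding triangle_delta_def by (auto simp: cInf_less_iff)
  then show ?thesis using rips_mono by auto
qed

lemma triangle_delta_le_Omega:
  assumes "triangle_in M d x y z l1 l2 l3" "perimeter d x y z \<le> t"
  shows "ennreal (triangle_delta d l1 l2 l3) \<le> Omega M d t"
  unfolding Omega_def using assms by (intro Sup_upper) blast

lemma Omega_leI:
  assumes "\<And>x y z l1 l2 l3. triangle_in M d x y z l1 l2 l3 \<Longrightarrow> perimeter d x y z \<le> t \<Longrightarrow> rips d c l1 l2 l3"
  shows "Omega M d t \<le> ennreal c"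
  unfolding Omega_def using assms triangle_delta_le by (intro Sup_least) (auto intro!: ennreal_leI)

lemma near_if_Omega_le:
  assumes \<Omega>: "Omega M d t \<le> ennreal c" "c \<ge> 0"
    and l: "seg x y l1" "seg y z l2" "seg z x l3" "d x y + d y z + d z x \<le> t" and p: "p \<in> l1"
  shows "\<exists>q\<in>l2 \<union> l3. d p q \<le> c + 1"
proof -
  have t: "triangle_in M d x y z l1 l2 l3" using l by (simp add: triangle_in_def)
  have "ennreal (triangle_delta d l1 l2 l3) \<le> ennreal c"
    using triangle_delta_le_Omega[OF t] l(4) \<Omega>(1) by (force simp: perimeter_def)
  then have "triangle_delta d l1 l2 l3 < c + 1/2" using \<Omega>(2) by (simp add: ennreal_le_iff)
  then have "rips d (c + 1/2) l1 l2 l3" by (rule rips_above_triangle_delta[OF t])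
  moreover have "l2 \<noteq> {}" using seg_ends[OF l(2)] by blast
  ultimately show ?thesis using rips_near[of _ l1 l2 l3 p "c + 1"] p by (metis add_strict_left_mono field_sum_of_halves half_gt_zero_iff less_add_same_cancel2 less_imp_le zero_less_one)
qed

end

text \<open>
  The optimal constant for the triangles of a given perimeter exists up to \<open>1\<close>, so the bound on it
  applies to every triangle.
\<close>

lemma (in linearly_thin) hyperbolic: "hyperbolic M d"
proof -
  have "rips d (200 * K) l1 l2 l3" if t: "triangle_in M d x y z l1 l2 l3" for x y z l1 l2 l3
  proof (rule rips_if_first_sides[OF t, of "\<lambda>_ _ _. True"])
    fix x y z l1 l2 l3 p assume t: "triangle_in M d x y z l1 l2 l3" and p: "p \<in> l1"
    define P where "P = (\<lambda>\<phi>. \<forall>a b c k1 k2 k3. \<forall>w\<in>k1. seg a b k1 \<longrightarrow> seg b c k2 \<longrightarrow> seg c a k3 \<longrightarrow>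
      d a b + d b c + d c a \<le> perimeter d x y z \<longrightarrow> (\<exists>q\<in>k2 \<union> k3. d w q \<le> \<phi>))"
    have l: "seg x y l1" "seg y z l2" "seg z x l3" using t by (auto simp: triangle_in_def)
    have "P (perimeter d x y z / 32 + C)"
      unfolding P_def
    proof (intro allI ballI impI)
      fix a b c k1 k2 k3 w
      assume "w \<in> k1" "seg a b k1" "seg b c k2" "seg c a k3" and le: "d a b + d b c + d c a \<le> perimeter d x y z"
      from this(1-4) obtain q where "q \<in> k2 \<union> k3" "d w q \<le> (d a b + d b c + d c a) / 32 + C"
        using thin by blast
      moreover have "(d a b + d b c + d c a) / 32 + C \<le> perimeter d x y z / 32 + C"
        using le by simp
      ultimately show "\<exists>q\<in>k2 \<union> k3. d w q \<le> perimeter d x y z / 32 + C"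
        by (meson order_trans)
    qed
    moreover have "P v" if "P u" "u \<le> v" for u v
      using that unfolding P_def by (meson order_trans)
    moreover have "\<not> P (- 1)"
    proof
      assume "P (- 1)"
      then obtain q where "d p q \<le> - 1" unfolding P_def using p l by (force simp: perimeter_def)
      then show False using nonneg[of p q] by linarith
    qed
    ultimately obtain \<phi> where \<phi>: "P \<phi>" "\<not> P (\<phi> - 1)" using exists_near_least by metis
    then obtain a b c k1 k2 k3 w where w: "w \<in> k1" "seg a b k1" "seg b c k2" "seg c a k3"
      "d a b + d b c + d c a \<le> perimeter d x y z" "\<And>q. q \<in> k2 \<union> k3 \<Longrightarrow> d w q > \<phi> - 1"
      unfolding P_def by (meson not_le)
    have "\<phi> \<le> 200 * K"
      by (rule fat_triangle_bounded[OF _ w(2-5,1,6)]) (use \<phi> in \<open>auto simp: P_def\<close>)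
    moreover have "\<exists>q\<in>l2 \<union> l3. d p q \<le> \<phi>"
      using \<phi>(1) p l unfolding P_def by (auto simp: perimeter_def)
    ultimately show "\<exists>q\<in>l2 \<union> l3. d p q \<le> 200 * K" by (meson order_trans)
  qed simp_all
  moreover have "geodesic_space M d"
    using seg_exists Metric_space_axioms by (auto simp: geodesic_space_def)
  ultimately show ?thesis
    unfolding hyperbolic_def delta_hyperbolic_def using C_nonneg by (intro exI[of _ "200 * K"]) auto
qed

lemma ennreal_one_32nd: "1 / 32 = ennreal (1 / 32)"
  by (simp add: divide_ennreal flip: ennreal_1 ennreal_numeral)

lemma ennreal_divide_less_iff:
  assumes "t > 0" "c > 0" shows "x / ennreal t < ennreal c \<longleftrightarrow> x < ennreal (c * t)"
proof (cases x)
  case (real r)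
  then show ?thesis using assms by (simp add: divide_ennreal ennreal_less_iff divide_less_eq)
next
  case top
  then show ?thesis using assms by (simp add: ennreal_top_divide)
qed

lemma hyperbolic_if_Limsup_Omega:
  assumes g: "geodesic_space M d" and L: "Limsup at_top (\<lambda>t::real. Omega M d t / ennreal t) < 1 / 32"
  shows "hyperbolic M d"
proof -
  interpret Metric_space M d using g by (simp add: geodesic_space_def)
  have "eventually (\<lambda>t. Omega M d t / ennreal t < ennreal (1/32)) at_top"
    using L unfolding ennreal_one_32nd by (rule Limsup_lessD)
  then obtain t0 where t0: "\<And>t. t \<ge> t0 \<Longrightarrow> Omega M d t / ennreal t < ennreal (1/32)"
    by (auto simp: eventually_at_top_linorder)
  define t1 where "t1 = max t0 1"
  have \<Omega>: "Omega M d t \<le> ennreal (t / 32)" if "t \<ge> t1" for t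
    using t0[of t] that ennreal_divide_less_iff[of t "1/32"] by (auto simp: t1_def)
  interpret linearly_thin M d "t1 / 32 + 1"
  proof
    fix x y z l1 l2 l3 p
    assume l: "seg x y l1" "seg y z l2" "seg z x l3" "p \<in> l1"
    define P where "P = d x y + d y z + d z x"
    have P: "P \<ge> 0" by (simp add: P_def)
    have m: "max P t1 / 32 \<ge> 0" "max P t1 \<le> P + t1" using P by (auto simp: t1_def)
    obtain q where "q \<in> l2 \<union> l3" "d p q \<le> max P t1 / 32 + 1"
      using near_if_Omega_le[OF \<Omega> m(1) l(1-3) _ l(4)] by (auto simp: P_def)
    moreover from this(2) have "d p q \<le> P / 32 + (t1 / 32 + 1)"
      using P m(2) by (simp add: field_simps max_def t1_def split: if_splits)
    ultimately show "\<exists>q\<in>l2 \<union> l3. d p q \<le> (d x y + d y z + d z x) / 32 + (t1 / 32 + 1)"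
      unfolding P_def[symmetric] by blast
  qed (use g in \<open>auto simp: geodesic_space_def t1_def\<close>)
  show ?thesis by (rule hyperbolic)
qed

lemma Limsup_Omega_if_hyperbolic:
  assumes "hyperbolic M d"
  shows "Limsup at_top (\<lambda>t::real. Omega M d t / ennreal t) < 1 / 32"
proof -
  obtain \<delta> where \<delta>: "\<delta> \<ge> 0" "delta_hyperbolic M d \<delta>" using assms by (auto simp: hyperbolic_def)
  then interpret Metric_space M d by (simp add: delta_hyperbolic_def geodesic_space_def)
  have \<Omega>: "Omega M d t \<le> ennreal \<delta>" for t
    using \<delta> by (intro Omega_leI) (simp add: delta_hyperbolic_def)
  have "Omega M d t / ennreal t < ennreal (1/33)" if "t \<ge> 33 * \<delta> + 1" for t
  proof -
    have "ennreal \<delta> < ennreal (1/33 * t)" using that \<delta>(1) by (intro ennreal_lessI) auto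
    then show ?thesis using \<Omega>[of t] that \<delta>(1) by (subst ennreal_divide_less_iff) auto
  qed
  then have "Limsup at_top (\<lambda>t::real. Omega M d t / ennreal t) \<le> ennreal (1/33)"
    by (intro Limsup_bounded eventually_mono[OF eventually_ge_at_top[of "33 * \<delta> + 1"]])
      (rule less_imp_le)
  also have "\<dots> < ennreal (1/32)" by (intro ennreal_lessI) auto
  finally show ?thesis unfolding ennreal_one_32nd .
qed

section \<open>Detours\<close>

lemma subdivision_in_unit:
  fixes p :: "nat \<Rightarrow> real"
  assumes "p 0 = 0" "p n = 1" "\<forall>i<n. p i \<le> p (Suc i)" "i \<le> n"
  shows "p i \<in> {0..1}"
proof -
  have "p 0 \<le> p i" using assms(4) assms(3)
    by (induction i) (auto intro: order_trans)
  moreover have "p i \<le> p n" using assms(4,3)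
  proof (induction rule: inc_induct)
    case (step j)
    then show ?case by (meson order_trans)
  qed simp
  ultimately show ?thesis using assms by simp
qed

context Metric_space
begin

lemma sum_le_curve_length:
  assumes "p 0 = 0" "p n = 1" "\<forall>i<n. p i \<le> p (Suc i)" "curve_length d \<gamma> \<le> ennreal L" "L \<ge> 0"
  shows "(\<Sum>i<n. d (\<gamma> (p i)) (\<gamma> (p (Suc i)))) \<le> L"
proof -
  have "ennreal (\<Sum>i<n. d (\<gamma> (p i)) (\<gamma> (p (Suc i)))) = (\<Sum>i<n. ennreal (d (\<gamma> (p i)) (\<gamma> (p (Suc i)))))"
    by (simp add: sum_ennreal)
  also have "\<dots> \<le> curve_length d \<gamma>"
    unfolding curve_length_def using assms by (intro Sup_upper) blast
  also have "\<dots> \<le> ennreal L" by fact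
  finally show ?thesis using assms(5) by (simp add: ennreal_le_iff)
qed

text \<open>Two consecutive geodesics form a curve whose length is at most the sum of theirs.\<close>

lemma concat_segs:
  assumes l2: "seg y z l2" and l3: "seg z x l3"
  obtains \<gamma> where "\<gamma> 0 = y" "\<gamma> 1 = x" "\<gamma> ` {0..1} \<subseteq> l2 \<union> l3"
    "continuous_map (top_of_set {0..1}) mtopology \<gamma>" "curve_length d \<gamma> \<le> ennreal (d y z + d z x)"
proof -
  obtain g where g: "g 0 = y" "g 1 = z" "l2 = g ` {0..1}" "l2 \<subseteq> M"
    and kg: "\<And>t s. t \<in> {0..1} \<Longrightarrow> s \<in> {0..1} \<Longrightarrow> d (g t) (g s) = d y z * \<bar>t - s\<bar>"
    using segE[OF l2] by metis
  obtain h where h: "h 0 = z" "h 1 = x" "l3 = h ` {0..1}" "l3 \<subseteq> M"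
    and kh: "\<And>t s. t \<in> {0..1} \<Longrightarrow> s \<in> {0..1} \<Longrightarrow> d (h t) (h s) = d z x * \<bar>t - s\<bar>"
    using segE[OF l3] by metis
  define \<gamma> where "\<gamma> = (\<lambda>s::real. if s \<le> 1/2 then g (2 * s) else h (2 * s - 1))"
  \<comment> \<open>The length of the part of the curve up to the parameter \<open>s\<close>.\<close>
  define F where "F = (\<lambda>s::real. if s \<le> 1/2 then d y z * (2 * s) else d y z + d z x * (2 * s - 1))"
  have im: "\<gamma> s \<in> l2 \<union> l3" if "s \<in> {0..1}" for s
    using that g(3) h(3) by (auto simp: \<gamma>_def)
  then have imM: "\<gamma> s \<in> M" if "s \<in> {0..1}" for s using that g(4) h(4) by blast
  have dF: "d (\<gamma> s) (\<gamma> t) \<le> F t - F s" if "s \<in> {0..1}" "t \<in> {0..1}" "s \<le> t" for s t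
  proof -
    consider "t \<le> 1/2" | "s > 1/2" | "s \<le> 1/2" "t > 1/2" by linarith
    then show ?thesis
    proof cases
      case 1
      then show ?thesis using kg[of "2 * s" "2 * t"] that by (simp add: \<gamma>_def F_def algebra_simps)
    next
      case 2
      then show ?thesis using kh[of "2 * s - 1" "2 * t - 1"] that
        by (simp add: \<gamma>_def F_def algebra_simps)
    next
      case 3
      have "d (\<gamma> s) (\<gamma> t) \<le> d (\<gamma> s) z + d z (\<gamma> t)"
        using imM that seg_mem[OF l2] by (intro triangle) auto
      moreover have "d (\<gamma> s) z = d y z * (1 - 2 * s)" "d z (\<gamma> t) = d z x * (2 * t - 1)"
        using kg[of "2 * s" 1] kh[of 0 "2 * t - 1"] 3 that g h by (simp_all add: \<gamma>_def abs_if)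
      ultimately show ?thesis using 3 by (simp add: F_def algebra_simps)
    qed
  qed
  define c where "c = 2 * (d y z + d z x)"
  have Flip: "F t - F s \<le> c * (t - s)" if "s \<le> t" for s t
  proof -
    have "0 \<le> d y z * (t - s)" "0 \<le> d z x * (t - s)" using that by simp_all
    moreover have "0 \<le> d y z * (2 * t - 1)" "0 \<le> d z x * (1 - 2 * s)" if "s \<le> 1/2" "\<not> t \<le> 1/2"
      using that by simp_all
    ultimately show ?thesis using that by (auto simp: F_def c_def algebra_simps)
  qed
  have lip: "d (\<gamma> s) (\<gamma> t) \<le> c * \<bar>s - t\<bar>" if "s \<in> {0..1}" "t \<in> {0..1}" for s t
    using dF[of s t] dF[of t s] Flip[of s t] Flip[of t s] that commute[of "\<gamma> s" "\<gamma> t"]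
    by (cases "s \<le> t") auto
  have cont: "continuous_map (top_of_set {0..1}) mtopology \<gamma>"
    unfolding continuous_map_to_metric
  proof (intro ballI allI impI)
    fix s \<epsilon> :: real assume s: "s \<in> topspace (top_of_set {0..1})" and \<epsilon>: "0 < \<epsilon>"
    have c: "c + 1 > 0" by (simp add: c_def add_nonneg_pos)
    define U where "U = {0..1} \<inter> ball s (\<epsilon> / (c + 1))"
    have "openin (top_of_set {0..1}) U" unfolding U_def by (intro openin_open_Int) simp
    moreover have "s \<in> U" using s \<epsilon> c by (simp add: U_def)
    moreover have "\<gamma> t \<in> mball (\<gamma> s) \<epsilon>" if "t \<in> U" for t
    proof -
      have t: "t \<in> {0..1}" "\<bar>s - t\<bar> < \<epsilon> / (c + 1)" using that by (auto simp: U_def dist_real_def)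
      have "d (\<gamma> s) (\<gamma> t) \<le> c * \<bar>s - t\<bar>" using lip s t by simp
      also have "\<dots> \<le> (c + 1) * \<bar>s - t\<bar>" by (simp add: mult_right_mono)
      also have "\<dots> < \<epsilon>" using t(2) c by (simp add: pos_less_divide_eq mult.commute)
      finally show ?thesis using imM s t by (simp add: in_mball)
    qed
    ultimately show "\<exists>U. openin (top_of_set {0..1}) U \<and> s \<in> U \<and> (\<forall>y\<in>U. \<gamma> y \<in> mball (\<gamma> s) \<epsilon>)"
      by blast
  qed
  have "curve_length d \<gamma> \<le> ennreal (d y z + d z x)"
    unfolding curve_length_def
  proof (rule Sup_least, clarify)
    fix n and p :: "nat \<Rightarrow> real" assume p: "p 0 = 0" "p n = 1" "\<forall>i<n. p i \<le> p (Suc i)"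
    have "(\<Sum>i<n. ennreal (d (\<gamma> (p i)) (\<gamma> (p (Suc i))))) = ennreal (\<Sum>i<n. d (\<gamma> (p i)) (\<gamma> (p (Suc i))))"
      by (simp add: sum_ennreal)
    also have "(\<Sum>i<n. d (\<gamma> (p i)) (\<gamma> (p (Suc i)))) \<le> (\<Sum>i<n. F (p (Suc i)) - F (p i))"
      using subdivision_in_unit[OF p] p by (intro sum_mono dF) auto
    also have "\<dots> = F (p n) - F (p 0)" by (rule sum_lessThan_telescope)
    also have "\<dots> = d y z + d z x" using p by (simp add: F_def)
    finally show "(\<Sum>i<n. ennreal (d (\<gamma> (p i)) (\<gamma> (p (Suc i))))) \<le> ennreal (d y z + d z x)"
      by (simp add: ennreal_leI)
  qed
  moreover have "\<gamma> 0 = y" "\<gamma> 1 = x" using g h by (simp_all add: \<gamma>_def)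
  moreover have "\<gamma> ` {0..1} \<subseteq> l2 \<union> l3" using im by blast
  ultimately show ?thesis using that cont by blast
qed

text \<open>A point of a side far from the other two sides makes these two sides a detour.\<close>

lemma detour_G_le_two_sides:
  assumes l: "seg x y l1" "seg y z l2" "seg z x l3" and p: "p \<in> l1"
    and far: "\<And>q. q \<in> l2 \<union> l3 \<Longrightarrow> t \<le> d p q"
  shows "detour_G M d t \<le> ennreal (perimeter d x y z - 2 * t)"
proof -
  obtain \<gamma> where \<gamma>: "\<gamma> 0 = y" "\<gamma> 1 = x" "\<gamma> ` {0..1} \<subseteq> l2 \<union> l3"
    "continuous_map (top_of_set {0..1}) mtopology \<gamma>" "curve_length d \<gamma> \<le> ennreal (d y z + d z x)"
    using concat_segs[OF l(2,3)] by metis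
  have "t \<le> dist_to_set d p (\<gamma> ` {0..1})"
    using \<gamma>(3) far by (intro dist_to_set_lower) auto
  then have "detour M d t \<gamma>"
    unfolding detour_def using \<gamma> seg_sym[OF l(1)] p by auto
  then have "detour_G M d t \<le> curve_length d \<gamma>"
    unfolding detour_G_def by (intro INF_lower) simp
  also have "\<dots> \<le> ennreal (d y z + d z x)" by (rule \<gamma>)
  also have "\<dots> \<le> ennreal (perimeter d x y z - 2 * t)"
  proof (rule ennreal_leI)
    have "t \<le> d p x" "t \<le> d p y" using far seg_ends[OF l(2)] seg_ends[OF l(3)] by auto
    then show "d y z + d z x \<le> perimeter d x y z - 2 * t"
      using seg_dist[OF l(1) p] commute[of x p] unfolding perimeter_def by linarith
  qed
  finally show ?thesis .
qed

lemma fine_subdivision: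
  assumes "continuous_map (top_of_set {0..1::real}) mtopology \<gamma>"
  obtains n :: nat where "n > 0" "\<And>i. i < n \<Longrightarrow> d (\<gamma> (real i / real n)) (\<gamma> (real (Suc i) / real n)) \<le> 1"
proof -
  have "\<forall>s\<in>{0..1}. \<exists>e>0. \<forall>t\<in>{0..1}. \<bar>s - t\<bar> < e \<longrightarrow> \<gamma> t \<in> mball (\<gamma> s) (1/2)"
  proof
    fix s :: real assume s: "s \<in> {0..1}"
    then obtain U where U: "openin (top_of_set {0..1}) U" "s \<in> U" "\<forall>y\<in>U. \<gamma> y \<in> mball (\<gamma> s) (1/2)"
      using assms unfolding continuous_map_to_metric by (metis half_gt_zero topspace_euclidean_subtopology zero_less_one)
    then obtain e where "e > 0" "\<And>t. t \<in> {0..1} \<Longrightarrow> dist t s < e \<Longrightarrow> t \<in> U"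
      unfolding openin_euclidean_subtopology_iff by metis
    then show "\<exists>e>0. \<forall>t\<in>{0..1}. \<bar>s - t\<bar> < e \<longrightarrow> \<gamma> t \<in> mball (\<gamma> s) (1/2)"
      using U by (intro exI[of _ e]) (auto simp: dist_real_def abs_minus_commute)
  qed
  then obtain e where e: "\<And>s. s \<in> {0..1} \<Longrightarrow> e s > 0"
    "\<And>s t. s \<in> {0..1} \<Longrightarrow> t \<in> {0..1} \<Longrightarrow> \<bar>s - t\<bar> < e s \<Longrightarrow> \<gamma> t \<in> mball (\<gamma> s) (1/2)"
    by metis
  have cover: "{0..1} \<subseteq> \<Union> ((\<lambda>s. ball s (e s)) ` {0..1})"
  proof
    fix t :: real assume t: "t \<in> {0..1}"
    then have "t \<in> ball t (e t)" using e(1) by simp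
    then show "t \<in> \<Union> ((\<lambda>s. ball s (e s)) ` {0..1})" using t by blast
  qed
  have op: "open G" if "G \<in> (\<lambda>s. ball s (e s)) ` {0..1}" for G using that by auto
  obtain r where r: "r > 0" "\<And>t. t \<in> {0..1} \<Longrightarrow> \<exists>G\<in>(\<lambda>s. ball s (e s)) ` {0..1}. ball t r \<subseteq> G"
    using Heine_Borel_lemma[OF compact_Icc cover op] by metis
  obtain n :: nat where n: "n > 0" "1 / real n < r"
    using r(1) by (metis inverse_eq_divide reals_Archimedean zero_less_Suc)
  have "d (\<gamma> (real i / real n)) (\<gamma> (real (Suc i) / real n)) \<le> 1" if i: "i < n" for i
  proof -
    let ?s = "real i / real n" and ?t = "real (Suc i) / real n"
    have I: "?s \<in> {0..1}" "?t \<in> {0..1}" using i by (auto simp: divide_simps)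
    obtain u where u: "u \<in> {0..1}" "ball ?s r \<subseteq> ball u (e u)" using r(2)[OF I(1)] by blast
    have "\<bar>?s - ?t\<bar> = 1 / real n" using n by (simp add: field_simps)
    then have "?s \<in> ball ?s r" "?t \<in> ball ?s r" using n r by (auto simp: dist_real_def)
    then have "?s \<in> ball u (e u)" "?t \<in> ball u (e u)" using u(2) by blast+
    then have "\<bar>u - ?s\<bar> < e u" "\<bar>u - ?t\<bar> < e u" unfolding mem_ball dist_real_def .
    then have "\<gamma> ?s \<in> mball (\<gamma> u) (1/2)" "\<gamma> ?t \<in> mball (\<gamma> u) (1/2)" using e(2) u I by blast+
    then show ?thesis
      using triangle[of "\<gamma> ?s" "\<gamma> u" "\<gamma> ?t"] commute[of "\<gamma> u" "\<gamma> ?s"] by (auto simp: in_mball)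
  qed
  then show ?thesis using that n by blast
qed

end

text \<open>
  Geodesic spaces whose triangles are \<open>D\<close>-thin, in the form that a point at distance at most \<open>D\<close> exists
  on the other sides.  In a \<open>\<delta>\<close>-hyperbolic space, where \<open>\<delta>\<close> bounds an infimum, every \<open>D > \<delta>\<close> has this
  property.
\<close>

locale uniformly_thin = Metric_space M d
  for M :: "'a set" and d :: "'a \<Rightarrow> 'a \<Rightarrow> real" +
  fixes D :: real
  assumes D_nonneg: "D \<ge> 0"
    and seg_exists: "x \<in> M \<Longrightarrow> y \<in> M \<Longrightarrow> \<exists>l. geodesic_between M d x y l"
    and thin: "geodesic_between M d x y l1 \<Longrightarrow> geodesic_between M d y z l2 \<Longrightarrow>
      geodesic_between M d z x l3 \<Longrightarrow> p \<in> l1 \<Longrightarrow> \<exists>q\<in>l2 \<union> l3. d p q \<le> D"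

lemma hyperbolic_imp_uniformly_thin:
  assumes "hyperbolic M d" obtains D where "uniformly_thin M d D"
proof -
  obtain \<delta> where \<delta>: "\<delta> \<ge> 0" "delta_hyperbolic M d \<delta>" using assms by (auto simp: hyperbolic_def)
  then interpret Metric_space M d by (simp add: delta_hyperbolic_def geodesic_space_def)
  have "uniformly_thin M d (\<delta> + 1)"
  proof
    fix x y z l1 l2 l3 p
    assume l: "seg x y l1" "seg y z l2" "seg z x l3" "p \<in> l1"
    have "rips d \<delta> l1 l2 l3" using \<delta>(2) l by (auto simp: delta_hyperbolic_def triangle_in_def)
    moreover have "l2 \<noteq> {}" using seg_ends[OF l(2)] by blast
    ultimately obtain q where "q \<in> l2 \<union> l3" "d p q < \<delta> + 1"
      using rips_near[of \<delta> l1 l2 l3 p "\<delta> + 1"] l(4) by auto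
    then show "\<exists>q\<in>l2 \<union> l3. d p q \<le> \<delta> + 1" by (intro bexI[of _ q]) auto
  qed (use \<delta> in \<open>auto simp: delta_hyperbolic_def geodesic_space_def\<close>)
  then show ?thesis by (rule that)
qed

context uniformly_thin
begin

text \<open>
  In a space with \<open>D\<close>-thin triangles a chain of points with steps at most \<open>1\<close> and total length at most
  \<open>2 ^ N\<close> passes near every geodesic joining its endpoints: cut the chain in two halves of at most
  half the length, up to one step between them.
\<close>

lemma chain_near_geodesic:
  fixes c :: "nat \<Rightarrow> 'a"
  assumes "i \<le> j" "\<And>k. k \<in> {i..j} \<Longrightarrow> c k \<in> M" "\<And>k. k \<in> {i..<j} \<Longrightarrow> d (c k) (c (Suc k)) \<le> 1"
    and "(\<Sum>k=i..<j. d (c k) (c (Suc k))) \<le> 2 ^ N" "seg (c i) (c j) l" "z \<in> l"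
  shows "\<exists>k\<in>{i..j}. d z (c k) \<le> 2 * D * real N + 1"
  using assms
proof (induction N arbitrary: i j l z)
  case 0
  have "d (c i) (c j) \<le> (\<Sum>k=i..<j. d (c k) (c (Suc k)))"
    using 0(1,2)
  proof (induction j rule: dec_induct)
    case (step n)
    have "d (c i) (c (Suc n)) \<le> d (c i) (c n) + d (c n) (c (Suc n))"
      using step by (intro triangle) auto
    then show ?case using step by (auto simp: sum.atLeastLessThan_Suc)
  qed (use 0(2) 0(1) in \<open>auto\<close>)
  then have "d (c i) (c j) \<le> 1" using 0(4) by simp
  then have "d (c i) z \<le> 1" using seg_dist[OF 0(5,6)] nonneg[of z "c j"] by linarith
  then show ?case using 0(1) by (intro bexI[of _ i]) (auto simp: commute)
next
  case (Suc N)
  define S where "S = (\<lambda>i j. \<Sum>k=i..<j. d (c k) (c (Suc k)))"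
  have split: "S i j = S i h + S h j" if "i \<le> h" "h \<le> j" for h
    unfolding S_def using that by (simp add: sum.atLeastLessThan_concat)
  have S_mono: "2 * D * real N + 1 \<le> 2 * D * real (Suc N) + 1" using D_nonneg by (simp add: algebra_simps)
  define h where "h = (GREATEST h. h \<le> j \<and> i \<le> h \<and> S i h \<le> 2 ^ N)"
  have "\<exists>h. h \<le> j \<and> i \<le> h \<and> S i h \<le> 2 ^ N"
    using Suc.prems(1) by (intro exI[of _ i]) (auto simp: S_def)
  then have h: "h \<le> j" "i \<le> h" "S i h \<le> 2 ^ N"
    unfolding h_def by (metis (mono_tags, lifting) GreatestI_nat)+
  have next_h: "S i (Suc h) > 2 ^ N" if "h < j"
  proof (rule ccontr)
    assume "\<not> ?thesis"
    then have "Suc h \<le> h" unfolding h_def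
      using that h by (intro Greatest_le_nat[of _ _ j]) (auto simp: h_def)
    then show False by simp
  qed
  show ?case
  proof (cases "h = j")
    case True
    then have "\<exists>k\<in>{i..j}. d z (c k) \<le> 2 * D * real N + 1"
      using h Suc.prems unfolding S_def by (intro Suc.IH) auto
    then show ?thesis using S_mono by force
  next
    case False
    then have hj: "h < j" using h by simp
    have cM: "c i \<in> M" "c h \<in> M" "c (Suc h) \<in> M" "c j \<in> M" "z \<in> M"
      using Suc.prems h hj seg_mem[OF Suc.prems(5)] by auto
    obtain la lb ls lc where s: "seg (c i) (c h) la" "seg (c h) (c j) lb"
      "seg (c h) (c (Suc h)) ls" "seg (c (Suc h)) (c j) lc"
      using seg_exists cM by metis
    have "S (Suc h) j \<le> 2 ^ N"
      using split[of "Suc h"] next_h[OF hj] h hj Suc.prems(4) unfolding S_def by simp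
    have near_c: "\<exists>k\<in>{i..j}. d v (c k) \<le> 2 * D * real N + 1" if "v \<in> lc" for v
    proof -
      have "\<exists>k\<in>{Suc h..j}. d v (c k) \<le> 2 * D * real N + 1"
        by (rule Suc.IH[OF _ _ _ _ s(4) that])
           (use \<open>S (Suc h) j \<le> 2 ^ N\<close> Suc.prems(2,3) hj h in \<open>simp_all add: S_def\<close>)
      then show ?thesis using h by (meson atLeastAtMost_iff le_SucI order_trans)
    qed
    have near_a: "\<exists>k\<in>{i..j}. d v (c k) \<le> 2 * D * real N + 1" if "v \<in> la" for v
    proof -
      have "\<exists>k\<in>{i..h}. d v (c k) \<le> 2 * D * real N + 1"
        by (rule Suc.IH[OF _ _ _ _ s(1) that])
           (use Suc.prems(2,3) hj h in \<open>simp_all add: S_def\<close>)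
      then show ?thesis using h by (meson atLeastAtMost_iff order_trans)
    qed
    have conclude: ?thesis if H: "d z v \<le> 2 * D" "\<exists>k\<in>{i..j}. d v (c k) \<le> 2 * D * real N + 1" "v \<in> M" for v
    proof -
      obtain k where k: "k \<in> {i..j}" "d v (c k) \<le> 2 * D * real N + 1" using H by blast
      have "d z (c k) \<le> d z v + d v (c k)" using cM H k Suc.prems(2) by (intro triangle) auto
      then show ?thesis using k H by (intro bexI[of _ k]) (auto simp: algebra_simps)
    qed
    obtain v where v: "v \<in> lb \<union> la" "d z v \<le> D"
      using thin[OF Suc.prems(5) seg_sym[OF s(2)] seg_sym[OF s(1)] Suc.prems(6)] by blast
    show ?thesis
    proof (cases "v \<in> la")
      case True
      have "d z v \<le> 2 * D" using v(2) D_nonneg by linarith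
      then show ?thesis using conclude[OF _ near_a[OF True] seg_mem(3)[OF s(1) True]] by blast
    next
      case False
      then have vb: "v \<in> lb" using v by blast
      obtain w where w: "w \<in> lc \<union> ls" "d v w \<le> D"
        using thin[OF s(2) seg_sym[OF s(4)] seg_sym[OF s(3)] vb] by blast
      have wM: "w \<in> M" "v \<in> M" using w vb seg_mem[OF s(4)] seg_mem[OF s(3)] seg_mem[OF s(2)] by blast+
      have zw: "d z w \<le> 2 * D" using triangle[of z v w] cM wM v w by linarith
      show ?thesis
      proof (cases "w \<in> lc")
        case True
        then show ?thesis using conclude[OF zw near_c wM(1)] by blast
      next
        case False
        then have "w \<in> ls" using w by blast
        moreover have "d (c h) (c (Suc h)) \<le> 1" using Suc.prems(3) h hj by simp
        ultimately have "d w (c h) \<le> 1"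
          using seg_dist[OF s(3), of w] nonneg[of w "c (Suc h)"] commute[of w "c h"] by linarith
        moreover have "0 \<le> 2 * D * real N" using D_nonneg by simp
        ultimately have "\<exists>k\<in>{i..j}. d w (c k) \<le> 2 * D * real N + 1"
          using h by (intro bexI[of _ h]) auto
        then show ?thesis using conclude[OF zw _ wM(1)] by blast
      qed
    qed
  qed
qed

text \<open>The length of a \<open>t\<close>-detour is at least exponential in \<open>t\<close>.\<close>

lemma detour_long:
  assumes det: "detour M d t \<gamma>" and len: "curve_length d \<gamma> \<le> ennreal (2 ^ N)"
  shows "t \<le> 2 * D * real N + 1"
proof -
  obtain l z where l: "seg (\<gamma> 0) (\<gamma> 1) l" "z \<in> l" "t \<le> dist_to_set d z (\<gamma> ` {0..1})"
    and cont: "continuous_map (top_of_set {0..1}) mtopology \<gamma>"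
    using det unfolding detour_def by blast
  have \<gamma>M: "\<gamma> s \<in> M" if "s \<in> {0..1}" for s
    using cont that unfolding continuous_map_to_metric
    by (metis in_mball topspace_euclidean_subtopology zero_less_one)
  obtain n where n: "n > 0" "\<And>i. i < n \<Longrightarrow> d (\<gamma> (real i / real n)) (\<gamma> (real (Suc i) / real n)) \<le> 1"
    using fine_subdivision[OF cont] by blast
  have unit: "real k / real n \<in> {0..1}" if "k \<le> n" for k using that n by (auto simp: divide_simps)
  have "(\<Sum>i<n. d (\<gamma> (real i / real n)) (\<gamma> (real (Suc i) / real n))) \<le> 2 ^ N"
    using n(1) by (intro sum_le_curve_length[OF _ _ _ len]) (auto simp: divide_right_mono)
  then obtain k where k: "k \<in> {0..n}" "d z (\<gamma> (real k / real n)) \<le> 2 * D * real N + 1"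
    using chain_near_geodesic[of 0 n "\<lambda>k. \<gamma> (real k / real n)" N l z] l n \<gamma>M[OF unit]
    by (auto simp: lessThan_atLeast0)
  have "dist_to_set d z (\<gamma> ` {0..1}) \<le> d z (\<gamma> (real k / real n))"
    using unit k by (intro dist_to_set_le) auto
  then show ?thesis using k l by linarith
qed

end

lemma linear_le_power2:
  fixes A B :: real
  assumes "A \<ge> 0" "B > 0"
  obtains N0 where "\<And>N. N \<ge> N0 \<Longrightarrow> A * real N + B \<le> 2 ^ N"
proof -
  have "(\<lambda>n. of_nat n / (2::real) ^ n) \<longlonglongrightarrow> 0" by (rule lim_n_over_pown) simp
  then have "\<forall>\<^sub>F n in sequentially. of_nat n / (2::real) ^ n < 1 / (A + B)"
    using assms by (intro order_tendstoD) (auto intro: divide_pos_pos)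
  then obtain N0 where N0: "\<And>N. N \<ge> N0 \<Longrightarrow> of_nat N / (2::real) ^ N < 1 / (A + B)"
    by (auto simp: eventually_sequentially)
  have "A * real N + B \<le> 2 ^ N" if "N \<ge> max N0 1" for N
  proof -
    have "A * real N + B \<le> (A + B) * real N"
      using that assms by (simp add: algebra_simps)
    also have "\<dots> \<le> 2 ^ N" using N0[of N] that assms by (simp add: field_simps)
    finally show ?thesis .
  qed
  then show ?thesis using that by blast
qed

lemma Liminf_detour_G_if_hyperbolic:
  assumes "hyperbolic M d"
  shows "Liminf at_top (\<lambda>t::real. detour_G M d t / ennreal t) > 30"
proof -
  obtain D where "uniformly_thin M d D" using hyperbolic_imp_uniformly_thin[OF assms] .
  then interpret uniformly_thin M d D .
  define A where "A = 2 * D + 1"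
  have A: "A > 0" using D_nonneg by (simp add: A_def)
  obtain N0 where N0: "\<And>N. N \<ge> N0 \<Longrightarrow> (31 * A) * real N + 31 * (A + 2) \<le> 2 ^ N"
    using linear_le_power2[of "31 * A" "31 * (A + 2)"] A by auto
  have G: "ennreal (31 * t) \<le> detour_G M d t" if t: "t \<ge> A * real N0 + 2" for t
  proof (rule ccontr)
    assume "\<not> ?thesis"
    then obtain \<gamma> where \<gamma>: "detour M d t \<gamma>" "curve_length d \<gamma> < ennreal (31 * t)"
      unfolding detour_G_def by (auto simp: not_le INF_less_iff)
    \<comment> \<open>With this \<open>N\<close> a curve of length \<open>2 ^ N\<close> is too short to be a \<open>t\<close>-detour, although \<open>2 ^ N \<ge> 31 * t\<close>.\<close>
    define N where "N = nat \<lfloor>(t - 2) / A\<rfloor>"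
    have q: "real N0 \<le> (t - 2) / A" using t A by (simp add: pos_le_divide_eq mult.commute)
    then have N: "N \<ge> N0" unfolding N_def by (simp add: le_nat_floor)
    have pos: "0 \<le> (t - 2) / A" using q by (meson of_nat_0_le_iff order_trans)
    have "real N \<le> (t - 2) / A" "(t - 2) / A < real N + 1"
      unfolding N_def using pos by linarith+
    then have Nt: "A * real N \<le> t - 2" "t - 2 < A * (real N + 1)"
      using A by (simp_all add: field_simps)
    then have "31 * t \<le> (31 * A) * real N + 31 * (A + 2)" by (simp add: algebra_simps)
    also have "\<dots> \<le> 2 ^ N" by (rule N0[OF N])
    finally have "ennreal (31 * t) \<le> ennreal (2 ^ N)" by (rule ennreal_leI)
    then have "curve_length d \<gamma> \<le> ennreal (2 ^ N)" using \<gamma>(2) by order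
    then have "t \<le> 2 * D * real N + 1" using detour_long[OF \<gamma>(1)] by blast
    also have "\<dots> \<le> A * real N + 1" by (simp add: A_def algebra_simps)
    finally show False using Nt by simp
  qed
  have "ennreal 31 \<le> detour_G M d t / ennreal t" if "t \<ge> A * real N0 + 2" for t
  proof -
    have "t > 0" using that A by (smt (verit) mult_nonneg_nonneg of_nat_0_le_iff)
    then have "ennreal 31 = ennreal (31 * t) / ennreal t" by (simp add: divide_ennreal)
    also have "\<dots> \<le> detour_G M d t / ennreal t" using G[OF that] by (rule divide_right_mono_ennreal)
    finally show ?thesis .
  qed
  then have "ennreal 31 \<le> Liminf at_top (\<lambda>t::real. detour_G M d t / ennreal t)"
    by (intro Liminf_bounded eventually_mono[OF eventually_ge_at_top[of "A * real N0 + 2"]])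
  moreover have "(30::ennreal) < ennreal 31" by (simp flip: ennreal_numeral add: ennreal_less_iff)
  ultimately show ?thesis by order
qed

text \<open>
  A triangle of perimeter \<open>t\<close> that is not \<open>s\<close>-thin yields an \<open>s\<close>-detour of length at most
  \<open>t - 2 * s\<close>; with \<open>s = t / 32\<close> this is \<open>30 * s\<close>.
\<close>

lemma Limsup_Omega_if_Liminf_detour_G:
  assumes g: "geodesic_space M d"
    and L: "Liminf at_top (\<lambda>t::real. detour_G M d t / ennreal t) > 30"
  shows "Limsup at_top (\<lambda>t::real. Omega M d t / ennreal t) < 1 / 32"
proof -
  interpret Metric_space M d using g by (simp add: geodesic_space_def)
  obtain b where b: "30 < b" "b < Liminf at_top (\<lambda>t::real. detour_G M d t / ennreal t)"
    using dense[OF L] by blast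
  obtain c where c: "b = ennreal c" "c \<ge> 0" using b(2) by (cases b) auto
  have c30: "c > 30" using b(1) c by (simp add: ennreal_less_iff flip: ennreal_numeral)
  have "eventually (\<lambda>t. ennreal c < detour_G M d t / ennreal t) at_top"
    using less_LiminfD[OF b(2)] c by simp
  then obtain t0 where t0: "\<And>t. t \<ge> t0 \<Longrightarrow> ennreal c < detour_G M d t / ennreal t"
    by (auto simp: eventually_at_top_linorder)
  have G: "ennreal (c * t) \<le> detour_G M d t" if "t \<ge> t0" "t > 0" for t
  proof (rule ccontr)
    assume "\<not> ?thesis"
    then have "detour_G M d t / ennreal t < ennreal c"
      using that c30 by (subst ennreal_divide_less_iff) auto
    then show False using t0[OF that(1)] by order
  qed
  define \<kappa> where "\<kappa> = 1 / (c + 2)"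
  have \<kappa>: "\<kappa> > 0" "\<kappa> < 1 / 32" using c30 by (auto simp: \<kappa>_def field_simps)
  have \<Omega>: "Omega M d t \<le> ennreal (\<kappa> * t + 1)" if t: "t > 0" "\<kappa> * t \<ge> t0" for t
  proof (rule Omega_leI)
    fix x y z l1 l2 l3 assume tri: "triangle_in M d x y z l1 l2 l3" and P: "perimeter d x y z \<le> t"
    show "rips d (\<kappa> * t + 1) l1 l2 l3"
    proof (rule rips_if_first_sides[OF tri, of "\<lambda>x y z. perimeter d x y z \<le> t"])
      fix x y z l1 l2 l3 p
      assume P: "perimeter d x y z \<le> t" and tri: "triangle_in M d x y z l1 l2 l3" and p: "p \<in> l1"
      show "\<exists>q\<in>l2 \<union> l3. d p q \<le> \<kappa> * t + 1"
      proof (rule ccontr)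
        assume far: "\<not> ?thesis"
        define s where "s = \<kappa> * t + 1"
        have s: "s > 0" "s \<ge> t0" using t \<kappa> by (auto simp: s_def intro: add_pos_pos)
        have far': "s \<le> d p q" if "q \<in> l2 \<union> l3" for q using far that unfolding s_def by (meson linear)
        have "c * s > 0" using c30 s by simp
        have "ennreal (c * s) \<le> detour_G M d s" using G s by blast
        also have "\<dots> \<le> ennreal (perimeter d x y z - 2 * s)"
          using tri far' p unfolding triangle_in_def by (intro detour_G_le_two_sides) auto
        also have "\<dots> \<le> ennreal (t - 2 * s)" using P by (intro ennreal_leI) simp
        finally have "c * s \<le> t - 2 * s"
          using \<open>c * s > 0\<close> by (simp add: ennreal_le_iff2)
        then have "(c + 2) * s \<le> t" by (simp add: algebra_simps)
        moreover have "(c + 2) * s = t + (c + 2)" using c30 by (simp add: s_def \<kappa>_def field_simps)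
        ultimately show False using c30 by simp
      qed
    qed (use P in \<open>auto simp: perimeter_def\<close>)
  qed
  define \<mu> where "\<mu> = (\<kappa> + 1 / 32) / 2"
  have \<mu>: "\<kappa> < \<mu>" "\<mu> < 1 / 32" using \<kappa> by (auto simp: \<mu>_def)
  define T where "T = max (max 1 (t0 / \<kappa>)) (1 / (\<mu> - \<kappa>))"
  have "Omega M d t / ennreal t \<le> ennreal \<mu>" if "t \<ge> T" for t
  proof -
    have t: "t > 0" "\<kappa> * t \<ge> t0" "1 \<le> (\<mu> - \<kappa>) * t"
      using that \<kappa> \<mu> by (auto simp: T_def pos_divide_le_eq mult.commute)
    have "Omega M d t \<le> ennreal (\<mu> * t)"
      using \<Omega>[OF t(1,2)] by (rule order_trans) (use t(3) in \<open>auto intro!: ennreal_leI simp: algebra_simps\<close>)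
    then have "Omega M d t / ennreal t \<le> ennreal (\<mu> * t) / ennreal t" by (rule divide_right_mono_ennreal)
    also have "\<dots> = ennreal \<mu>" using t \<kappa> \<mu> by (simp add: divide_ennreal)
    finally show ?thesis .
  qed
  then have "Limsup at_top (\<lambda>t::real. Omega M d t / ennreal t) \<le> ennreal \<mu>"
    by (intro Limsup_bounded eventually_mono[OF eventually_ge_at_top[of T]])
  also have "\<dots> < ennreal (1 / 32)" using \<mu> by (intro ennreal_lessI) auto
  finally show ?thesis unfolding ennreal_one_32nd .
qed

section \<open>Ultrafilters\<close>

text \<open>An ultrafilter is a minimal proper filter, here below the filter of cofinite sets.\<close>

lemma exists_nonprincipal_ultrafilter:
  "\<exists>\<omega> :: nat filter. ultrafilter \<omega> \<and> nonprincipal \<omega>"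
proof -
  define A where "A = {F :: nat filter. F \<noteq> bot \<and> F \<le> sequentially}"
  define P where "P = (\<lambda>F G :: nat filter. G \<le> F)"
  have "\<exists>m\<in>A. \<forall>F\<in>A. P m F \<longrightarrow> F = m"
  proof (rule predicate_Zorn)
    show "partial_order_on A (relation_of P A)"
      by (rule partial_order_on_relation_ofI) (auto simp: P_def)
    fix C assume C: "C \<in> Chains (relation_of P A)"
    have CA: "C \<subseteq> A" using C by (auto simp: Chains_def relation_of_def)
    have lin: "F \<le> G \<or> G \<le> F" if "F \<in> C" "G \<in> C" for F G
      using C that by (auto simp: Chains_def relation_of_def P_def)
    show "\<exists>u\<in>A. \<forall>F\<in>C. P F u"
    proof (cases "C = {}")
      case True
      have "sequentially \<in> A" by (simp add: A_def)
      with True show ?thesis by blast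
    next
      case False
      have "eventually Q (Inf C) \<longleftrightarrow> (\<exists>F\<in>C. eventually Q F)" for Q
        by (rule eventually_Inf_base[OF False]) (metis lin inf.absorb1 inf.absorb2 order_refl)
      then have "Inf C \<noteq> bot"
        using CA unfolding trivial_limit_def A_def by blast
      moreover have "Inf C \<le> sequentially"
        using False CA unfolding A_def by (metis (mono_tags, lifting) Inf_lower2 all_not_in_conv mem_Collect_eq subsetD)
      ultimately show ?thesis by (intro bexI[of _ "Inf C"]) (auto simp: P_def A_def Inf_lower)
    qed
  qed
  then obtain \<omega> where \<omega>: "\<omega> \<noteq> bot" "\<omega> \<le> sequentially"
    and min: "\<And>F. F \<noteq> bot \<Longrightarrow> F \<le> \<omega> \<Longrightarrow> F = \<omega>"
    unfolding A_def P_def by (metis (mono_tags, lifting) mem_Collect_eq order_trans)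
  have "eventually (\<lambda>n. n \<in> S) \<omega> \<or> eventually (\<lambda>n. n \<in> - S) \<omega>" for S
  proof (cases "inf \<omega> (principal S) = bot")
    case True
    then show ?thesis by (simp add: trivial_limit_def eventually_inf_principal)
  next
    case False
    then have "inf \<omega> (principal S) = \<omega>" using min by simp
    moreover have "eventually (\<lambda>n. n \<in> S) (inf \<omega> (principal S))"
      by (simp add: eventually_inf_principal)
    ultimately show ?thesis by simp
  qed
  then have "ultrafilter \<omega>" using \<omega> by (simp add: ultrafilter_def)
  moreover have "nonprincipal \<omega>"
    unfolding nonprincipal_def
  proof (intro allI impI notI)
    fix S :: "nat set" assume "finite S" and S: "eventually (\<lambda>n. n \<in> S) \<omega>"
    then obtain N where "\<forall>n\<in>S. n < N" using finite_nat_set_iff_bounded by blast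
    then have "eventually (\<lambda>n. n \<notin> S) sequentially"
      unfolding eventually_sequentially by (meson not_le)
    then have "eventually (\<lambda>n. n \<notin> S) \<omega>" using \<omega>(2) by (simp add: filter_leD)
    with S have "eventually (\<lambda>n. False) \<omega>" by eventually_elim simp
    then show False using \<omega>(1) by (simp add: trivial_limit_def)
  qed
  ultimately show ?thesis by blast
qed

lemma nonprincipal_le_sequentially:
  assumes u: "ultrafilter \<omega>" and n: "nonprincipal \<omega>"
  shows "\<omega> \<le> sequentially"
proof (rule filter_leI)
  fix P :: "nat \<Rightarrow> bool" assume "eventually P sequentially"
  then obtain N where N: "\<And>n. n \<ge> N \<Longrightarrow> P n" by (auto simp: eventually_sequentially)
  have "eventually (\<lambda>n. n \<in> - {..<N}) \<omega>"
    using u n unfolding ultrafilter_def nonprincipal_def by (metis finite_lessThan)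
  then show "eventually P \<omega>" by eventually_elim (simp add: N)
qed

lemma ultrafilter_unit_limit:
  fixes s :: "nat \<Rightarrow> real"
  assumes u: "ultrafilter \<omega>" and s: "\<And>n. s n \<in> {0..1}"
  obtains \<sigma> where "\<sigma> \<in> {0..1}" "(s \<longlongrightarrow> \<sigma>) \<omega>"
proof -
  have lim: "((\<lambda>n. ennreal (s n)) \<longlongrightarrow> ultralim \<omega> (\<lambda>n. ennreal (s n))) \<omega>"
    by (rule ultralim_tendsto[OF u])
  have "ultralim \<omega> (\<lambda>n. ennreal (s n)) \<le> 1"
    using u s by (intro tendsto_upperbound[OF lim]) (auto simp: ultrafilter_def)
  then obtain \<sigma> where \<sigma>: "ultralim \<omega> (\<lambda>n. ennreal (s n)) = ennreal \<sigma>" "\<sigma> \<ge> 0" "\<sigma> \<le> 1"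
    by (cases "ultralim \<omega> (\<lambda>n. ennreal (s n))") (auto simp: top_unique)
  then have "(s \<longlongrightarrow> \<sigma>) \<omega>" using lim s by (intro tendsto_ennrealD) auto
  then show ?thesis using that \<sigma> by auto
qed

section \<open>Asymptotic cones\<close>

text \<open>
  The data of an asymptotic cone.  The divergence of the scaling factors is not part of it, as the
  cone is a metric space without it.
\<close>

locale cone = Metric_space M d
  for M :: "'a set" and d :: "'a \<Rightarrow> 'a \<Rightarrow> real" +
  fixes \<omega> :: "nat filter" and x :: "nat \<Rightarrow> 'a" and r :: "nat \<Rightarrow> real"
  assumes ultra: "ultrafilter \<omega>" and r_pos: "\<forall>n. r n > 0" and base: "range x \<subseteq> M"
begin

abbreviation Seqs :: "(nat \<Rightarrow> 'a) set" where "Seqs \<equiv> cone_seqs M d \<omega> x r"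
abbreviation Cone :: "(nat \<Rightarrow> 'a) set set" where "Cone \<equiv> asymptotic_cone M d \<omega> x r"
abbreviation cd :: "(nat \<Rightarrow> 'a) set \<Rightarrow> (nat \<Rightarrow> 'a) set \<Rightarrow> real" where "cd \<equiv> cone_dist d \<omega> r"

text \<open>The point of the cone represented by a sequence.\<close>

definition cls :: "(nat \<Rightarrow> 'a) \<Rightarrow> (nat \<Rightarrow> 'a) set" where
  "cls y = cone_rel M d \<omega> x r `` {y}"

sublocale C: Metric_space Cone cd
  by (rule Metric_space_cone[OF ultra r_pos base])

lemma omega_ne_bot: "\<omega> \<noteq> bot"
  using ultra by (simp add: ultrafilter_def)

lemma SeqsD: "y \<in> Seqs \<Longrightarrow> y n \<in> M"
  by (auto simp: cone_seqs_def)

lemma cls_in: "y \<in> Seqs \<Longrightarrow> cls y \<in> Cone"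
  unfolding cls_def asymptotic_cone_def by (rule quotientI)

lemma in_cls: "y \<in> Seqs \<Longrightarrow> y \<in> cls y"
  unfolding cls_def by (rule equiv_class_self[OF equiv_cone_rel[OF ultra r_pos]])

lemma ConeE:
  assumes "Y \<in> Cone" obtains y where "y \<in> Seqs" "Y = cls y"
  using assms unfolding asymptotic_cone_def cls_def by (elim quotientE)

lemma dist_tendsto:
  assumes "y \<in> Seqs" "z \<in> Seqs"
  shows "((\<lambda>n. d (y n) (z n) / r n) \<longlongrightarrow> cd (cls y) (cls z)) \<omega>"
proof (rule tendsto_ennrealD)
  have "ennreal (cd (cls y) (cls z)) = cone_lim d \<omega> r y z"
    using assms by (intro cone_dist_class[OF ultra r_pos base] cls_in in_cls)
  then show "((\<lambda>n. ennreal (d (y n) (z n) / r n)) \<longlongrightarrow> ennreal (cd (cls y) (cls z))) \<omega>"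
    using ultralim_tendsto[OF ultra, of "\<lambda>n. ennreal (d (y n) (z n) / r n)"] by (simp add: cone_lim_def)
  show "\<forall>\<^sub>F n in \<omega>. 0 \<le> d (y n) (z n) / r n"
    using r_pos by (intro always_eventually) (simp add: less_imp_le)
qed simp

lemma dist_eqI:
  "y \<in> Seqs \<Longrightarrow> z \<in> Seqs \<Longrightarrow> ((\<lambda>n. d (y n) (z n) / r n) \<longlongrightarrow> L) \<omega> \<Longrightarrow> cd (cls y) (cls z) = L"
  using tendsto_unique[OF omega_ne_bot dist_tendsto] by blast

lemma cls_eqI:
  assumes "y \<in> Seqs" "z \<in> Seqs" "((\<lambda>n. d (y n) (z n) / r n) \<longlongrightarrow> 0) \<omega>"
  shows "cls y = cls z"
  using dist_eqI[OF assms] C.zero cls_in assms by blast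

lemma SeqsI:
  assumes y: "y \<in> Seqs" and z: "\<And>n. z n \<in> M" and b: "\<forall>\<^sub>F n in \<omega>. d (y n) (z n) / r n \<le> c"
  shows "z \<in> Seqs"
proof -
  have "cone_lim d \<omega> r y z \<le> ennreal c"
    unfolding cone_lim_def
    by (rule tendsto_upperbound[OF ultralim_tendsto[OF ultra] _ omega_ne_bot])
       (use b in \<open>auto elim!: eventually_mono intro: ennreal_leI\<close>)
  moreover have "cone_lim d \<omega> r x z \<le> cone_lim d \<omega> r x y + cone_lim d \<omega> r y z"
    using base y z by (intro cone_lim_triangle[OF ultra r_pos]) (auto simp: cone_seqs_def)
  moreover have "cone_lim d \<omega> r x y < \<infinity>" using y by (simp add: cone_seqs_def)
  ultimately have "cone_lim d \<omega> r x z < \<infinity>"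
    by (metis ennreal_add_less_top ennreal_less_top infinity_ennreal_def le_less_trans)
  then show ?thesis using z by (auto simp: cone_seqs_def)
qed

lemma base_in_Seqs: "x \<in> Seqs"
  using cone_lim_refl[OF ultra base] base by (simp add: cone_seqs_def)

text \<open>Geodesics of \<open>M\<close> joining the terms of two sequences converge to a geodesic of the cone.\<close>

lemma limit_geodesic:
  assumes y: "y \<in> Seqs" and z: "z \<in> Seqs"
    and g: "\<And>n. g n 0 = y n" "\<And>n. g n 1 = z n" "\<And>n. g n ` {0..1} \<subseteq> M"
    and dg: "\<And>n t s. t \<in> {0..1} \<Longrightarrow> s \<in> {0..1} \<Longrightarrow> d (g n t) (g n s) = d (y n) (z n) * \<bar>t - s\<bar>"
  shows limit_geodesic_Seqs: "(\<And>n. \<sigma> n \<in> {0..1}) \<Longrightarrow> (\<lambda>n. g n (\<sigma> n)) \<in> Seqs"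
    and limit_geodesic_seg: "C.seg (cls y) (cls z) ((\<lambda>t. cls (\<lambda>n. g n t)) ` {0..1})"
proof -
  show S: "(\<lambda>n. g n (\<sigma> n)) \<in> Seqs" if \<sigma>: "\<And>n. \<sigma> n \<in> {0..1}" for \<sigma>
  proof (rule SeqsI[OF y])
    show "g n (\<sigma> n) \<in> M" for n using g(3)[of n] \<sigma>[of n] by blast
    have "\<forall>\<^sub>F n in \<omega>. d (y n) (z n) / r n < cd (cls y) (cls z) + 1"
      using order_tendstoD(2)[OF dist_tendsto[OF y z]] by simp
    then show "\<forall>\<^sub>F n in \<omega>. d (y n) (g n (\<sigma> n)) / r n \<le> cd (cls y) (cls z) + 1"
    proof eventually_elim
      case (elim n)
      have "d (y n) (g n (\<sigma> n)) \<le> d (y n) (z n)"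
        using dg[of 0 "\<sigma> n" n] \<sigma>[of n] g(1) mult_left_mono[of "\<sigma> n" 1 "d (y n) (z n)"] by simp
      then have "d (y n) (g n (\<sigma> n)) / r n \<le> d (y n) (z n) / r n"
        using r_pos by (intro divide_right_mono) (auto simp: less_imp_le)
      then show ?case using elim by simp
    qed
  qed
  show "C.seg (cls y) (cls z) ((\<lambda>t. cls (\<lambda>n. g n t)) ` {0..1})"
  proof (rule C.segI[where k = "cd (cls y) (cls z)"])
    show "(\<lambda>t. cls (\<lambda>n. g n t)) ` {0..1} \<subseteq> Cone"
      using S[of "\<lambda>_. t" for t] cls_in by auto
    show "cls (\<lambda>n. g n 0) = cls y" "cls (\<lambda>n. g n 1) = cls z" using g by simp_all
    fix t s :: real assume ts: "t \<in> {0..1}" "s \<in> {0..1}"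
    have "((\<lambda>n. d (y n) (z n) / r n * \<bar>t - s\<bar>) \<longlongrightarrow> cd (cls y) (cls z) * \<bar>t - s\<bar>) \<omega>"
      by (intro tendsto_intros dist_tendsto y z)
    then have "((\<lambda>n. d (g n t) (g n s) / r n) \<longlongrightarrow> cd (cls y) (cls z) * \<bar>t - s\<bar>) \<omega>"
      using dg[OF ts] by simp
    then show "cd (cls (\<lambda>n. g n t)) (cls (\<lambda>n. g n s)) = cd (cls y) (cls z) * \<bar>t - s\<bar>"
      using S[of "\<lambda>_. t"] S[of "\<lambda>_. s"] ts by (intro dist_eqI) auto
  qed simp_all
qed

lemma geodesic_space_cone:
  assumes "geodesic_space M d" shows "geodesic_space Cone cd"
  unfolding geodesic_space_def
proof (intro conjI ballI)
  show "Metric_space Cone cd" by (rule C.Metric_space_axioms)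
  fix Y Z assume "Y \<in> Cone" "Z \<in> Cone"
  then obtain y z where yz: "y \<in> Seqs" "z \<in> Seqs" "Y = cls y" "Z = cls z" by (metis ConeE)
  have "\<exists>\<gamma>. \<gamma> 0 = y n \<and> \<gamma> 1 = z n \<and> \<gamma> ` {0..1} \<subseteq> M \<and>
      (\<forall>t\<in>{0..1}. \<forall>s\<in>{0..1}. d (\<gamma> t) (\<gamma> s) = d (y n) (z n) * \<bar>t - s\<bar>)" for n
  proof -
    obtain l where "seg (y n) (z n) l"
      using assms SeqsD[OF yz(1)] SeqsD[OF yz(2)] unfolding geodesic_space_def by blast
    then show ?thesis by (elim segE) metis
  qed
  then obtain g where g: "\<And>n. g n 0 = y n" "\<And>n. g n 1 = z n" "\<And>n. g n ` {0..1} \<subseteq> M"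
    "\<And>n t s. t \<in> {0..1} \<Longrightarrow> s \<in> {0..1} \<Longrightarrow> d (g n t) (g n s) = d (y n) (z n) * \<bar>t - s\<bar>"
    by metis
  then show "\<exists>l. C.seg Y Z l" using limit_geodesic_seg[OF yz(1,2) g] yz(3,4) by auto
qed

end

section \<open>Cones of hyperbolic spaces are real trees\<close>

context uniformly_thin
begin

text \<open>A point that almost lies between \<open>x\<close> and \<open>y\<close> is close to every geodesic \<open>[x,y]\<close>.\<close>

lemma near_segment:
  assumes l: "seg x y l" and p: "p \<in> M"
  obtains m where "m \<in> l" "d p m \<le> (d x p + d p y - d x y) / 2 + (2 * D + 1)"
proof -
  obtain la lb where s: "seg x p la" "seg p y lb" using seg_exists p seg_mem[OF l] by metis
  have near: "\<exists>q\<in>lb \<union> la. d w q \<le> D" if "w \<in> l" for w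
    using thin[OF l seg_sym[OF s(2)] seg_sym[OF s(1)] that] .
  obtain w w' where w: "w \<in> l" "w' \<in> l" "d w w' \<le> 1" "\<exists>q\<in>la. d w q \<le> D" "\<exists>q\<in>lb. d w' q \<le> D"
    using seg_switch[OF l, of "\<lambda>w. \<exists>q\<in>la. d w q \<le> D" "\<lambda>w. \<exists>q\<in>lb. d w q \<le> D"] near
      seg_ends(1)[OF s(1)] seg_ends(2)[OF s(2)] D_nonneg mdist_zero seg_mem[OF l] by (metis Un_iff)
  then obtain v v' where v: "v \<in> la" "d w v \<le> D" "v' \<in> lb" "d w' v' \<le> D" by blast
  have M: "w \<in> M" "w' \<in> M" "v \<in> M" "v' \<in> M" "x \<in> M" "y \<in> M"
    using w v seg_mem[OF l] seg_mem[OF s(1)] seg_mem[OF s(2)] by blast+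
  have wv': "d w v' \<le> D + 1" using triangle[of w w' v'] M w v by linarith
  have "d x w \<le> d x v + d w v" "d p w \<le> d v p + d w v"
    using triangle[of x v w] triangle[of p v w] M p by (simp_all add: commute)
  moreover have "d p w \<le> d p v' + d w v'" "d w y \<le> d w v' + d v' y"
    using triangle[of p v' w] triangle[of w v' y] M p by (simp_all add: commute)
  ultimately have "2 * d p w \<le> d x p + d p y - d x y + 4 * D + 2"
    using seg_dist[OF s(1) v(1)] seg_dist[OF s(2) v(3)] seg_dist[OF l w(1)] v(2) wv' by linarith
  then show ?thesis using that[OF w(1)] by (simp add: field_simps)
qed

text \<open>Coarse uniqueness: points almost between \<open>y\<close> and \<open>z\<close> are determined by their distance from \<open>y\<close>.\<close>

lemma between_determined:
  assumes M: "y \<in> M" "z \<in> M" "p \<in> M" "q \<in> M"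
  shows "d p q \<le> \<bar>d y p - d y q\<bar> + (d y p + d p z - d y z) + (d y q + d q z - d y z) + 4 * (2 * D + 1)"
proof -
  obtain l where l: "seg y z l" using seg_exists M by blast
  obtain m where m: "m \<in> l" "d p m \<le> (d y p + d p z - d y z) / 2 + (2 * D + 1)"
    using near_segment[OF l M(3)] .
  obtain n where n: "n \<in> l" "d q n \<le> (d y q + d q z - d y z) / 2 + (2 * D + 1)"
    using near_segment[OF l M(4)] .
  have mn: "m \<in> M" "n \<in> M" using m n seg_mem[OF l] by blast+
  have "d m n = \<bar>d y m - d y n\<bar>" using seg_order[OF l m(1) n(1)] .
  moreover have "\<bar>d y m - d y p\<bar> \<le> d p m" "\<bar>d y n - d y q\<bar> \<le> d q n"
    using triangle[of y p m] triangle[of y m p] triangle[of y q n] triangle[of y n q] M mn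
      commute[of m p] commute[of n q] by linarith+
  ultimately have "d m n \<le> \<bar>d y p - d y q\<bar> + d p m + d q n" by linarith
  moreover have "d p q \<le> d p m + d m n + d q n"
    using triangle[of p m q] triangle[of m n q] M mn commute[of n q] by linarith
  ultimately have "d p q \<le> \<bar>d y p - d y q\<bar> + 2 * d p m + 2 * d q n" by linarith
  then show ?thesis using m(2) n(2) by (simp add: field_simps)
qed

end

text \<open>
  Asymptotic cones of a space with uniformly thin triangles.  Divergence of the scaling factors is only
  needed along the ultrafilter.
\<close>

locale cone_of_thin = cone M d \<omega> x r + uniformly_thin M d D
  for M :: "'a set" and d :: "'a \<Rightarrow> 'a \<Rightarrow> real" and \<omega> :: "nat filter"
    and x :: "nat \<Rightarrow> 'a" and r :: "nat \<Rightarrow> real" and D :: real +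
  assumes r_infinity: "filterlim r at_top \<omega>"
begin

lemma const_tendsto_0: "((\<lambda>n. c / r n) \<longlongrightarrow> 0) \<omega>"
  using r_infinity by (intro tendsto_divide_0[OF tendsto_const] filterlim_at_top_imp_at_infinity)

text \<open>
  In the limit the coarse uniqueness becomes exact, which makes geodesics of the cone unique, also those
  that do not come from geodesics of \<open>M\<close>.
\<close>

lemma cone_between_unique:
  assumes "Y \<in> Cone" "Z \<in> Cone" "P \<in> Cone" "Q \<in> Cone"
    and "cd Y P + cd P Z = cd Y Z" "cd Y Q + cd Q Z = cd Y Z" "cd Y P = cd Y Q"
  shows "P = Q"
proof -
  obtain y z p q where s: "y \<in> Seqs" "z \<in> Seqs" "p \<in> Seqs" "q \<in> Seqs"
    and c: "Y = cls y" "Z = cls z" "P = cls p" "Q = cls q"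
    using assms(1-4) by (metis ConeE)
  have "cd (cls p) (cls q) \<le> \<bar>cd (cls y) (cls p) - cd (cls y) (cls q)\<bar>
      + (cd (cls y) (cls p) + cd (cls p) (cls z) - cd (cls y) (cls z))
      + (cd (cls y) (cls q) + cd (cls q) (cls z) - cd (cls y) (cls z)) + 0"
  proof (rule tendsto_le[OF omega_ne_bot _ dist_tendsto[OF s(3,4)]])
    show "((\<lambda>n. \<bar>d (y n) (p n) / r n - d (y n) (q n) / r n\<bar>
      + (d (y n) (p n) / r n + d (p n) (z n) / r n - d (y n) (z n) / r n)
      + (d (y n) (q n) / r n + d (q n) (z n) / r n - d (y n) (z n) / r n) + 4 * (2 * D + 1) / r n)
      \<longlongrightarrow> \<bar>cd (cls y) (cls p) - cd (cls y) (cls q)\<bar>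
      + (cd (cls y) (cls p) + cd (cls p) (cls z) - cd (cls y) (cls z))
      + (cd (cls y) (cls q) + cd (cls q) (cls z) - cd (cls y) (cls z)) + 0) \<omega>"
      by (intro tendsto_intros dist_tendsto const_tendsto_0 s)
    have "d (p n) (q n) / r n \<le> \<bar>d (y n) (p n) / r n - d (y n) (q n) / r n\<bar>
      + (d (y n) (p n) / r n + d (p n) (z n) / r n - d (y n) (z n) / r n)
      + (d (y n) (q n) / r n + d (q n) (z n) / r n - d (y n) (z n) / r n) + 4 * (2 * D + 1) / r n" for n
    proof -
      have rn: "r n > 0" using r_pos by simp
      have "d (p n) (q n) / r n \<le> (\<bar>d (y n) (p n) - d (y n) (q n)\<bar> + (d (y n) (p n) + d (p n) (z n) - d (y n) (z n))
          + (d (y n) (q n) + d (q n) (z n) - d (y n) (z n)) + 4 * (2 * D + 1)) / r n"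
        using between_determined[of "y n" "z n" "p n" "q n"] s SeqsD rn
        by (intro divide_right_mono) auto
      also have "\<bar>d (y n) (p n) - d (y n) (q n)\<bar> = \<bar>d (y n) (p n) / r n - d (y n) (q n) / r n\<bar> * r n"
        using rn by (simp add: abs_divide flip: diff_divide_distrib)
      finally show ?thesis using rn by (simp add: add_divide_distrib diff_divide_distrib)
    qed
    then show "\<forall>\<^sub>F n in \<omega>. d (p n) (q n) / r n \<le> \<bar>d (y n) (p n) / r n - d (y n) (q n) / r n\<bar>
      + (d (y n) (p n) / r n + d (p n) (z n) / r n - d (y n) (z n) / r n)
      + (d (y n) (q n) / r n + d (q n) (z n) / r n - d (y n) (z n) / r n) + 4 * (2 * D + 1) / r n"
      by (rule always_eventually[OF allI])
  qed
  then have "cd P Q \<le> 0" using assms(5-7) c by simp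
  then have "cd P Q = 0" using C.nonneg[of P Q] by linarith
  then show ?thesis using assms by simp
qed

lemma cone_between_mem:
  assumes l: "C.seg Y Z l" and P: "P \<in> Cone" "cd Y P + cd P Z = cd Y Z"
  shows "P \<in> l"
proof -
  have "cd Y P \<le> cd Y Z" using P(2) C.nonneg[of P Z] by linarith
  then obtain Q where Q: "Q \<in> l" "cd Y Q = cd Y P" using C.seg_point[OF l C.nonneg[of Y P]] by blast
  have "P = Q"
    using C.seg_mem[OF l] Q P C.seg_dist[OF l Q(1)] by (intro cone_between_unique[of Y Z]) auto
  then show ?thesis using Q by simp
qed

lemma cone_between_limit:
  assumes s: "y \<in> Seqs" "z \<in> Seqs" "q \<in> Seqs"
    and e: "\<forall>\<^sub>F n in \<omega>. d (y n) (q n) + d (q n) (z n) = d (y n) (z n)"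
  shows "cd (cls y) (cls q) + cd (cls q) (cls z) = cd (cls y) (cls z)"
proof (rule tendsto_unique[OF omega_ne_bot _ dist_tendsto[OF s(1,2)]])
  have "((\<lambda>n. d (y n) (q n) / r n + d (q n) (z n) / r n) \<longlongrightarrow> cd (cls y) (cls q) + cd (cls q) (cls z)) \<omega>"
    by (intro tendsto_intros dist_tendsto s)
  then show "((\<lambda>n. d (y n) (z n) / r n) \<longlongrightarrow> cd (cls y) (cls q) + cd (cls q) (cls z)) \<omega>"
    by (rule Lim_transform_eventually) (use e in eventually_elim, simp flip: add_divide_distrib)
qed

text \<open>
  A point of one side of a triangle of the cone is represented by points of one of the other two sides
  of triangles in \<open>M\<close>, the same one along the ultrafilter.
\<close>

lemma cone_side_in_other_sides:
  assumes l: "C.seg X Y l1" "C.seg Y Z l2" "C.seg Z X l3" and P: "P \<in> l1"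
  shows "P \<in> l2 \<union> l3"
proof -
  obtain a y z p where s: "a \<in> Seqs" "y \<in> Seqs" "z \<in> Seqs" "p \<in> Seqs"
    and c: "X = cls a" "Y = cls y" "Z = cls z" "P = cls p"
    using C.seg_mem[OF l(1)] C.seg_mem[OF l(2)] P by (metis ConeE)
  have "\<exists>q\<in>M. d (p n) q \<le> (d (a n) (p n) + d (p n) (y n) - d (a n) (y n)) / 2 + (3 * D + 1) \<and>
     (d (y n) q + d q (z n) = d (y n) (z n) \<or> d (z n) q + d q (a n) = d (z n) (a n))" for n
  proof -
    obtain la lb lc where k: "seg (a n) (y n) la" "seg (y n) (z n) lb" "seg (z n) (a n) lc"
      using seg_exists SeqsD s by metis
    obtain m where m: "m \<in> la" "d (p n) m \<le> (d (a n) (p n) + d (p n) (y n) - d (a n) (y n)) / 2 + (2 * D + 1)"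
      using near_segment[OF k(1) SeqsD[OF s(4)]] .
    obtain q where q: "q \<in> lb \<union> lc" "d m q \<le> D" using thin[OF k m(1)] by blast
    have mq: "m \<in> M" "q \<in> M" using m q seg_mem[OF k(1)] seg_mem[OF k(2)] seg_mem[OF k(3)] by blast+
    have "d (p n) q \<le> d (p n) m + d m q" using triangle SeqsD[OF s(4)] mq by blast
    then show ?thesis using m q mq seg_dist[OF k(2)] seg_dist[OF k(3)] by (intro bexI[of _ q]) auto
  qed
  then obtain q where q: "\<And>n. q n \<in> M"
    "\<And>n. d (p n) (q n) \<le> (d (a n) (p n) + d (p n) (y n) - d (a n) (y n)) / 2 + (3 * D + 1)"
    "\<And>n. d (y n) (q n) + d (q n) (z n) = d (y n) (z n) \<or> d (z n) (q n) + d (q n) (a n) = d (z n) (a n)"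
    by metis
  have lim: "((\<lambda>n. d (p n) (q n) / r n) \<longlongrightarrow> 0) \<omega>"
  proof (rule tendsto_sandwich[OF _ _ tendsto_const])
    have "((\<lambda>n. (d (a n) (p n) / r n + d (p n) (y n) / r n - d (a n) (y n) / r n) / 2 + (3 * D + 1) / r n)
        \<longlongrightarrow> (cd X P + cd P Y - cd X Y) / 2 + 0) \<omega>"
      unfolding c by (intro tendsto_intros dist_tendsto const_tendsto_0 s) simp
    then show "((\<lambda>n. (d (a n) (p n) / r n + d (p n) (y n) / r n - d (a n) (y n) / r n) / 2 + (3 * D + 1) / r n)
        \<longlongrightarrow> 0) \<omega>"
      using C.seg_dist[OF l(1) P] by simp
    show "\<forall>\<^sub>F n in \<omega>. 0 \<le> d (p n) (q n) / r n"
      using r_pos by (intro always_eventually) (simp add: less_imp_le)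
    have "d (p n) (q n) / r n \<le> (d (a n) (p n) / r n + d (p n) (y n) / r n - d (a n) (y n) / r n) / 2
        + (3 * D + 1) / r n" for n
    proof -
      have rn: "r n > 0" using r_pos by simp
      have "d (p n) (q n) / r n \<le> ((d (a n) (p n) + d (p n) (y n) - d (a n) (y n)) / 2 + (3 * D + 1)) / r n"
        using q(2) rn by (intro divide_right_mono) auto
      then show ?thesis by (simp add: add_divide_distrib diff_divide_distrib)
    qed
    then show "\<forall>\<^sub>F n in \<omega>. d (p n) (q n) / r n \<le> (d (a n) (p n) / r n + d (p n) (y n) / r n - d (a n) (y n) / r n) / 2
        + (3 * D + 1) / r n"
      by (rule always_eventually[OF allI])
  qed
  have qs: "q \<in> Seqs"
  proof (rule SeqsI[OF s(4) q(1)])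
    have "\<forall>\<^sub>F n in \<omega>. d (p n) (q n) / r n < 1" using order_tendstoD(2)[OF lim] by simp
    then show "\<forall>\<^sub>F n in \<omega>. d (p n) (q n) / r n \<le> 1" by eventually_elim simp
  qed
  have Pq: "P = cls q" using cls_eqI[OF s(4) qs lim] c by simp
  define S where "S = {n. d (y n) (q n) + d (q n) (z n) = d (y n) (z n)}"
  have "eventually (\<lambda>n. n \<in> S) \<omega> \<or> eventually (\<lambda>n. n \<in> - S) \<omega>"
    using ultra by (simp add: ultrafilter_def)
  then show ?thesis
  proof
    assume "eventually (\<lambda>n. n \<in> S) \<omega>"
    then have "cd Y P + cd P Z = cd Y Z"
      unfolding Pq c(2,3) using s qs by (intro cone_between_limit) (auto simp: S_def)
    then show ?thesis using cone_between_mem[OF l(2)] cls_in[OF qs] Pq by blast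
  next
    assume "eventually (\<lambda>n. n \<in> - S) \<omega>"
    then have "eventually (\<lambda>n. d (z n) (q n) + d (q n) (a n) = d (z n) (a n)) \<omega>"
      by eventually_elim (use q(3) in \<open>auto simp: S_def\<close>)
    then have "cd Z P + cd P X = cd Z X"
      unfolding Pq c(1,3) using s qs by (intro cone_between_limit)
    then show ?thesis using cone_between_mem[OF l(3)] cls_in[OF qs] Pq by blast
  qed
qed

lemma real_tree_cone: "real_tree Cone cd"
  unfolding real_tree_def delta_hyperbolic_def
proof (intro conjI allI impI)
  have "geodesic_space M d" using seg_exists Metric_space_axioms by (auto simp: geodesic_space_def)
  then show "geodesic_space Cone cd" by (rule geodesic_space_cone)
  fix X Y Z l1 l2 l3 assume t: "triangle_in Cone cd X Y Z l1 l2 l3"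
  show "rips cd 0 l1 l2 l3"
  proof (rule C.rips_if_first_sides[OF t, of "\<lambda>_ _ _. True"])
    fix X Y Z l1 l2 l3 P assume "triangle_in Cone cd X Y Z l1 l2 l3" and P: "P \<in> l1"
    then have l: "C.seg X Y l1" "C.seg Y Z l2" "C.seg Z X l3" by (auto simp: triangle_in_def)
    have "cd P P \<le> 0" using C.seg_mem[OF l(1)] P by simp
    then show "\<exists>Q\<in>l2 \<union> l3. cd P Q \<le> 0" using cone_side_in_other_sides[OF l P] by blast
  qed simp_all
qed

end

lemma real_tree_cone_if_hyperbolic:
  assumes h: "hyperbolic M d" and \<omega>: "ultrafilter \<omega>" "nonprincipal \<omega>"
    and x: "range x \<subseteq> M" and r: "\<forall>n. r n > 0" "filterlim r at_top sequentially"
  shows "real_tree (asymptotic_cone M d \<omega> x r) (cone_dist d \<omega> r)"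
proof -
  obtain D where "uniformly_thin M d D" using hyperbolic_imp_uniformly_thin[OF h] .
  then interpret uniformly_thin M d D .
  interpret cone_of_thin M d \<omega> x r D
  proof
    show "filterlim r at_top \<omega>"
      using r(2) nonprincipal_le_sequentially[OF \<omega>] by (rule filterlim_mono[OF _ order_refl])
  qed (use assms in auto)
  show ?thesis by (rule real_tree_cone)
qed

section \<open>Spaces all of whose cones are real trees\<close>

lemma (in Metric_space) fat_triangle_if_Omega_gt:
  assumes "ennreal c < Omega M d t" "c \<ge> 0"
  obtains x y z l1 l2 l3 p where "seg x y l1" "seg y z l2" "seg z x l3" "perimeter d x y z \<le> t"
    "p \<in> l1" "\<And>q. q \<in> l2 \<union> l3 \<Longrightarrow> c < d p q"
proof (rule ccontr)
  assume none: "\<not> thesis"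
  have "Omega M d t \<le> ennreal c"
  proof (rule Omega_leI)
    fix x y z l1 l2 l3 assume t: "triangle_in M d x y z l1 l2 l3" and P: "perimeter d x y z \<le> t"
    show "rips d c l1 l2 l3"
    proof (rule rips_if_first_sides[OF t, of "\<lambda>x y z. perimeter d x y z \<le> t"])
      fix x y z l1 l2 l3 p
      assume "perimeter d x y z \<le> t" "triangle_in M d x y z l1 l2 l3" "p \<in> l1"
      then show "\<exists>q\<in>l2 \<union> l3. d p q \<le> c"
        using none that[of x y l1 z l2 l3 p] by (meson not_le triangle_in_def)
    qed (use P in \<open>auto simp: perimeter_def\<close>)
  qed
  then show False using assms by simp
qed

text \<open>
  If \<open>\<Omega> t\<close> were at least \<open>t / 33\<close> for arbitrarily large \<open>t\<close>, rescaling fat triangles of larger and larger perimeter would produce in the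
  limit a triangle of a cone with a point at positive distance from the other two sides.
\<close>

lemma Limsup_Omega_if_real_tree_cones:
  assumes g: "geodesic_space M d"
    and cones: "\<And>(\<omega>::nat filter) x (r::nat \<Rightarrow> real). ultrafilter \<omega> \<Longrightarrow> nonprincipal \<omega> \<Longrightarrow>
      range x \<subseteq> M \<Longrightarrow> \<forall>n. r n > 0 \<Longrightarrow> filterlim r at_top sequentially \<Longrightarrow>
      real_tree (asymptotic_cone M d \<omega> x r) (cone_dist d \<omega> r)"
  shows "Limsup at_top (\<lambda>t::real. Omega M d t / ennreal t) < 1 / 32"
proof (rule ccontr)
  assume L: "\<not> ?thesis"
  interpret Metric_space M d using g by (simp add: geodesic_space_def)
  \<comment> \<open>The three parametrised sides of each triangle are chosen together with it.\<close>
  define G where "G = (\<lambda>a b (\<gamma> :: real \<Rightarrow> 'a). \<gamma> 0 = a \<and> \<gamma> 1 = b \<and> \<gamma> ` {0..1} \<subseteq> M \<and>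
        (\<forall>s\<in>{0..1}. \<forall>s'\<in>{0..1}. d (\<gamma> s) (\<gamma> s') = d a b * \<bar>s - s'\<bar>))"
  have GE: "\<exists>g. G a b g \<and> l = g ` {0..1}" if H: "seg a b l" for a b l
  proof -
    obtain g where "g 0 = a" "g 1 = b" "l = g ` {0..1}" "l \<subseteq> M"
      "\<And>s s'. s \<in> {0..1} \<Longrightarrow> s' \<in> {0..1} \<Longrightarrow> d (g s) (g s') = d a b * \<bar>s - s'\<bar>"
      using segE[OF H] by metis
    then show ?thesis unfolding G_def by (intro exI[of _ g]) blast
  qed
  have "\<exists>t x y z g1 g2 g3 \<sigma>. t \<ge> real n + 1 \<and> perimeter d x y z \<le> t \<and> \<sigma> \<in> {0..1} \<and>
      G x y g1 \<and> G y z g2 \<and> G z x g3 \<and>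
      (\<forall>s\<in>{0..1}. t / 33 < d (g1 \<sigma>) (g2 s) \<and> t / 33 < d (g1 \<sigma>) (g3 s))" for n
  proof -
    have "\<exists>t\<ge>real n + 1. ennreal (t / 33) < Omega M d t"
    proof (rule ccontr)
      assume "\<not> ?thesis"
      then have \<Omega>: "Omega M d t \<le> ennreal (t / 33)" if "t \<ge> real n + 1" for t
        using that by (meson not_le)
      have "Omega M d t / ennreal t \<le> ennreal (1 / 33)" if "t \<ge> real n + 1" for t
      proof -
        have "Omega M d t / ennreal t \<le> ennreal (t / 33) / ennreal t"
          using \<Omega>[OF that] by (rule divide_right_mono_ennreal)
        also have "\<dots> = ennreal (1 / 33)" using that by (simp add: divide_ennreal)
        finally show ?thesis .
      qed
      then have "Limsup at_top (\<lambda>t::real. Omega M d t / ennreal t) \<le> ennreal (1 / 33)"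
        by (intro Limsup_bounded eventually_mono[OF eventually_ge_at_top[of "real n + 1"]])
      also have "\<dots> < ennreal (1 / 32)" by (intro ennreal_lessI) auto
      finally show False using L unfolding ennreal_one_32nd by blast
    qed
    then obtain t where t: "t \<ge> real n + 1" "ennreal (t / 33) < Omega M d t" by blast
    have "t / 33 \<ge> 0" using t by simp
    then obtain x y z l1 l2 l3 p where l: "seg x y l1" "seg y z l2" "seg z x l3" "perimeter d x y z \<le> t"
      "p \<in> l1" "\<And>q. q \<in> l2 \<union> l3 \<Longrightarrow> t / 33 < d p q"
      using fat_triangle_if_Omega_gt[OF t(2)] by metis
    obtain g1 g2 g3 where g: "G x y g1" "l1 = g1 ` {0..1}" "G y z g2" "l2 = g2 ` {0..1}"
      "G z x g3" "l3 = g3 ` {0..1}"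
      using GE l(1-3) by metis
    obtain \<sigma> where \<sigma>: "\<sigma> \<in> {0..1}" "p = g1 \<sigma>" using l(5) g(2) by blast
    have "\<forall>s\<in>{0..1}. t / 33 < d (g1 \<sigma>) (g2 s) \<and> t / 33 < d (g1 \<sigma>) (g3 s)"
      using l(6) g(4,6) \<sigma>(2) by blast
    then show ?thesis using t(1) l(4) \<sigma>(1) g(1,3,5) by blast
  qed
  then obtain t x y z g1 g2 g3 \<sigma> where
    t: "\<And>n. t n \<ge> real n + 1" and per: "\<And>n. perimeter d (x n) (y n) (z n) \<le> t n"
    and \<sigma>: "\<And>n. \<sigma> n \<in> {0..1}"
    and gs: "\<And>n. G (x n) (y n) (g1 n)" "\<And>n. G (y n) (z n) (g2 n)" "\<And>n. G (z n) (x n) (g3 n)"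
    and far: "\<And>n s. s \<in> {0..1} \<Longrightarrow> t n / 33 < d (g1 n (\<sigma> n)) (g2 n s)"
      "\<And>n s. s \<in> {0..1} \<Longrightarrow> t n / 33 < d (g1 n (\<sigma> n)) (g3 n s)"
    by metis
  have GD: "\<gamma> 0 = a" "\<gamma> 1 = b" "\<gamma> ` {0..1} \<subseteq> M"
    "\<And>s s'. s \<in> {0..1} \<Longrightarrow> s' \<in> {0..1} \<Longrightarrow> d (\<gamma> s) (\<gamma> s') = d a b * \<bar>s - s'\<bar>"
    if "G a b \<gamma>" for a b \<gamma>
    using that by (simp_all add: G_def)
  note g1 = GD[OF gs(1)] and g2 = GD[OF gs(2)] and g3 = GD[OF gs(3)]
  have endpoint: "a \<in> M" if "G a b \<gamma>" for a b \<gamma>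
    using GD(1,3)[OF that] by (auto simp: image_subset_iff)
  have xyz: "x n \<in> M" "y n \<in> M" "z n \<in> M" for n
    using endpoint gs by blast+
  have t_pos: "t n > 0" for n using t[of n] by linarith
  obtain \<omega> :: "nat filter" where \<omega>: "ultrafilter \<omega>" "nonprincipal \<omega>"
    using exists_nonprincipal_ultrafilter by blast
  interpret cone M d \<omega> x t
    by unfold_locales (use \<omega> t_pos xyz in auto)
  have "real n \<le> t n" for n using t[of n] by linarith
  then have "filterlim t at_top sequentially"
    by (intro filterlim_at_top_mono[OF filterlim_real_sequentially] always_eventually allI)
  then have tree: "real_tree Cone cd" using cones \<omega> base r_pos by blast
  have ys: "y \<in> Seqs" and zs: "z \<in> Seqs"
  proof -
    have "d (x n) (y n) / t n \<le> 1" "d (x n) (z n) / t n \<le> 1" for n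
      using per[of n] t_pos[of n] nonneg[of "x n" "y n"] nonneg[of "y n" "z n"] nonneg[of "z n" "x n"]
        commute[of "z n" "x n"]
      unfolding perimeter_def by (simp_all only: pos_divide_le_eq)
    then show "y \<in> Seqs" "z \<in> Seqs"
      using xyz by (auto intro!: SeqsI[OF base_in_Seqs] always_eventually)
  qed
  note xs = base_in_Seqs
  let ?L1 = "(\<lambda>s. cls (\<lambda>n. g1 n s)) ` {0..1}"
  let ?L2 = "(\<lambda>s. cls (\<lambda>n. g2 n s)) ` {0..1}"
  let ?L3 = "(\<lambda>s. cls (\<lambda>n. g3 n s)) ` {0..1}"
  have "triangle_in Cone cd (cls x) (cls y) (cls z) ?L1 ?L2 ?L3"
    unfolding triangle_in_def
    using limit_geodesic_seg[OF xs ys g1] limit_geodesic_seg[OF ys zs g2] limit_geodesic_seg[OF zs xs g3]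
    by blast
  then have rips: "rips cd 0 ?L1 ?L2 ?L3" using tree by (auto simp: real_tree_def delta_hyperbolic_def)
  obtain s where s: "s \<in> {0..1}" "(\<sigma> \<longlongrightarrow> s) \<omega>" using ultrafilter_unit_limit[where s = \<sigma>, OF ultra \<sigma>] by blast
  have ps: "(\<lambda>n. g1 n (\<sigma> n)) \<in> Seqs" "(\<lambda>n. g1 n s) \<in> Seqs"
    by (rule limit_geodesic_Seqs[OF xs ys g1], use \<sigma> s(1) in simp_all)+
  have "cls (\<lambda>n. g1 n (\<sigma> n)) = cls (\<lambda>n. g1 n s)"
  proof (rule cls_eqI[OF ps])
    have "((\<lambda>n. d (x n) (y n) / t n * \<bar>\<sigma> n - s\<bar>) \<longlongrightarrow> cd (cls x) (cls y) * \<bar>s - s\<bar>) \<omega>"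
      by (intro tendsto_intros dist_tendsto xs ys s)
    then show "((\<lambda>n. d (g1 n (\<sigma> n)) (g1 n s) / t n) \<longlongrightarrow> 0) \<omega>"
      using g1(4)[OF \<sigma> s(1)] by simp
  qed
  then have "cls (\<lambda>n. g1 n (\<sigma> n)) \<in> ?L1" using s(1) by blast
  moreover have "?L2 \<noteq> {}" by simp
  ultimately obtain Q where Q: "Q \<in> ?L2 \<union> ?L3" "cd (cls (\<lambda>n. g1 n (\<sigma> n))) Q < 1 / 33"
    using C.rips_near[OF rips, of _ "1/33"] by auto
  then obtain q where q: "q \<in> Seqs" "Q = cls q" "\<And>n. t n / 33 < d (g1 n (\<sigma> n)) (q n)"
  proof -
    consider u where "u \<in> {0..1}" "Q = cls (\<lambda>n. g2 n u)" | u where "u \<in> {0..1}" "Q = cls (\<lambda>n. g3 n u)"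
      using Q(1) by blast
    then show ?thesis
    proof cases
      case 1
      then show ?thesis
        using that[of "\<lambda>n. g2 n u", OF limit_geodesic_Seqs[OF ys zs g2, of "\<lambda>_. u"]] far(1)[OF 1(1)]
        by simp
    next
      case 2
      then show ?thesis
        using that[of "\<lambda>n. g3 n u", OF limit_geodesic_Seqs[OF zs xs g3, of "\<lambda>_. u"]] far(2)[OF 2(1)]
        by simp
    qed
  qed
  have "1 / 33 \<le> cd (cls (\<lambda>n. g1 n (\<sigma> n))) (cls q)"
  proof (rule tendsto_lowerbound[OF dist_tendsto[OF ps(1) q(1)] _ omega_ne_bot])
    have "1 / 33 \<le> d (g1 n (\<sigma> n)) (q n) / t n" for n
      using q(3)[of n] t_pos[of n] by (simp add: field_simps)
    then show "\<forall>\<^sub>F n in \<omega>. 1 / 33 \<le> d (g1 n (\<sigma> n)) (q n) / t n"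
      by (rule always_eventually[OF allI])
  qed
  then show False using Q(2) q(2) by simp
qed

section \<open>The characterisation of hyperbolicity\<close>

theorem proposition10:
  fixes M :: "'a set" and d :: "'a \<Rightarrow> 'a \<Rightarrow> real"
  assumes "geodesic_space M d"
  shows "(hyperbolic M d \<longleftrightarrow>
            (\<forall>(\<omega>::nat filter) (x::nat \<Rightarrow> 'a) (r::nat \<Rightarrow> real).
               ultrafilter \<omega> \<longrightarrow> nonprincipal \<omega> \<longrightarrow>
               range x \<subseteq> M \<longrightarrow> (\<forall>n. r n > 0) \<longrightarrow> filterlim r at_top sequentially \<longrightarrow>
               real_tree (asymptotic_cone M d \<omega> x r) (cone_dist d \<omega> r)))
       \<and> (hyperbolic M d \<longleftrightarrow>
            Liminf at_top (\<lambda>t::real. detour_G M d t / ennreal t) > 30)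
       \<and> (hyperbolic M d \<longleftrightarrow>
            Limsup at_top (\<lambda>t::real. Omega M d t / ennreal t) < 1 / 32)"
proof (intro conjI iffI)
  show "hyperbolic M d" if "Limsup at_top (\<lambda>t::real. Omega M d t / ennreal t) < 1 / 32"
    using hyperbolic_if_Limsup_Omega[OF assms that] .
  show "hyperbolic M d" if "Liminf at_top (\<lambda>t::real. detour_G M d t / ennreal t) > 30"
    using hyperbolic_if_Limsup_Omega[OF assms Limsup_Omega_if_Liminf_detour_G[OF assms that]] .
  show "hyperbolic M d" if cones: "\<forall>(\<omega>::nat filter) (x::nat \<Rightarrow> 'a) (r::nat \<Rightarrow> real).
      ultrafilter \<omega> \<longrightarrow> nonprincipal \<omega> \<longrightarrow>
      range x \<subseteq> M \<longrightarrow> (\<forall>n. r n > 0) \<longrightarrow> filterlim r at_top sequentially \<longrightarrow>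
      real_tree (asymptotic_cone M d \<omega> x r) (cone_dist d \<omega> r)"
    using Limsup_Omega_if_real_tree_cones[OF assms] cones
    by (intro hyperbolic_if_Limsup_Omega[OF assms]) blast
  show "\<forall>(\<omega>::nat filter) (x::nat \<Rightarrow> 'a) (r::nat \<Rightarrow> real).
      ultrafilter \<omega> \<longrightarrow> nonprincipal \<omega> \<longrightarrow>
      range x \<subseteq> M \<longrightarrow> (\<forall>n. r n > 0) \<longrightarrow> filterlim r at_top sequentially \<longrightarrow>
      real_tree (asymptotic_cone M d \<omega> x r) (cone_dist d \<omega> r)" if "hyperbolic M d"
    using real_tree_cone_if_hyperbolic[OF that] by blast
qed (use Liminf_detour_G_if_hyperbolic Limsup_Omega_if_hyperbolic in blast)+

end
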